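(* Let $G=(V,E)$ be a finite looped graph, and let $(G,\bm{\ell},\mathbf n,\mathbf s)$ be a bar-slider framework with a generic realization $G(\mathbf p)$. Then $G(\mathbf p)$ is minimally slider-pinning rigid if and only if $G$ is a looped-Laman graph.
   Context: Looped graph: a graph $G=(V,E)$ with $n$ vertices, $m$ edges between distinct vertices and $c$ self-loops (at most two parallel copies of each edge and at most two loops per vertex). In this paper "edge" means a non-loop edge; $i_j$ denotes the $j$-th loop on vertex $i$. Looped-Laman graph: a looped graph with $m+c=2n$ such that (i) every subgraph with $n'\ge 2$ vertices has at most $2n'-3$ edges (loops not counted), and (ii) every subgraph with $n'$ vertices, $m'$ edges and $c'$ loops satisfies $m'+c'\le 2n'$. Bar-slider framework $(G,\bm{\ell},\mathbf n,\mathbf s)$: a looped graph $G$, a positive real number $\ell_{ij}$ (squared length) for each edge $ij$, and for each loop $i_j$ a line $\{\mathbf x\in\mathbb R^2:\langle \mathbf n_{i_j},\mathbf x\rangle = s_{i_j}\}$ with nonzero normal $\mathbf n_{i_j}=(c_{i_j},d_{i_j})\in\mathbb R^2$ and $s_{i_j}\in\mathbb R$. A realization $G(\mathbf p)$ is given by $\mathbf p=(\mathbf p_1,\dots,\mathbf p_n)\in(\mathbb R^2)^n$ with $\|\mathbf p_i-\mathbf p_j\|^2=\ell_{ij}$ for all edges $ij$ and $\langle \mathbf p_i,\mathbf n_{i_j}\rangle=s_{i_j}$ for all loops $i_j$. The configuration space $\mathcal C(G)\subset(\mathbb R^2)^n$ is the set of all such $\mathbf p$. $G(\mathbf p)$ is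 slider-pinning rigid (pinned) if $\mathbf p$ is an isolated point of $\mathcal C(G)$. It is minimally slider-pinning rigid (minimally rigid, minimally pinned) if it is pinned but is no longer pinned after removal of any single edge or any single loop (together with its constraint). Pinned rigidity matrix: write $\mathbf p_i=(a_i,b_i)$. The $(m+c)\times 2n$ matrix $\mathbf M_{2,0,3}(G)$ has two columns per vertex. The row of an edge $ij$ has entries $(a_i-a_j,\,b_i-b_j)$ in the columns of $i$, $(a_j-a_i,\,b_j-b_i)$ in the columns of $j$, and zeros elsewhere. The row of a loop $i_j$ has entries $(c_{i_j},d_{i_j})$ in the columns of $i$ and zeros elsewhere. Its generic rank is its rank when $a_i,b_i,c_{i_j},d_{i_j}$ are regarded as independent formal variables, i.e. the largest $r$ such that some $r\times r$ minor is not identically zero. A realization $G(\mathbf p)$ is generic if the rank of $\mathbf M_{2,0,3}(G)$ evaluated at the actual values $(\mathbf p,\mathbf n)$ equals the generic rank. *)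

theory Defs
  imports
    "HOL-Analysis.Analysis"
    "HOL-Library.Poly_Mapping"
    "Jordan_Normal_Form.Determinant"
begin

text \<open>
  The vertex set is all of the finite type \<open>'v\<close>.  Edges and loops carry abstract names, so that
  parallel copies remain distinct; an edge has an unordered pair of ends.
\<close>

record ('v, 'e, 'l) looped_graph =
  edges :: "'e set"
  ends :: "'e \<Rightarrow> 'v set"
  loops :: "'l set"
  base :: "'l \<Rightarrow> 'v"

definition wf_looped_graph :: "('v, 'e, 'l) looped_graph \<Rightarrow> bool" where
  "wf_looped_graph G \<longleftrightarrow>
     finite (edges G) \<and> finite (loops G) \<and>
     (\<forall>e\<in>edges G. card (ends G e) = 2) \<and>
     (\<forall>e\<in>edges G. card {f \<in> edges G. ends G f = ends G e} \<le> 2) \<and>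
     (\<forall>v. card {l \<in> loops G. base G l = v} \<le> 2)"

definition is_subgraph ::
    "'v set \<Rightarrow> 'e set \<Rightarrow> 'l set \<Rightarrow> ('v, 'e, 'l) looped_graph \<Rightarrow> bool" where
  "is_subgraph V' E' L' G \<longleftrightarrow>
     E' \<subseteq> edges G \<and> L' \<subseteq> loops G \<and>
     (\<forall>e\<in>E'. ends G e \<subseteq> V') \<and> (\<forall>l\<in>L'. base G l \<in> V')"

definition looped_laman :: "('v::finite, 'e, 'l) looped_graph \<Rightarrow> bool" where
  "looped_laman G \<longleftrightarrow>
     card (edges G) + card (loops G) = 2 * CARD('v) \<and>
     (\<forall>V' E' L'. is_subgraph V' E' L' G \<longrightarrow> 2 \<le> card V' \<longrightarrow> card E' \<le> 2 * card V' - 3) \<and>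
     (\<forall>V' E' L'. is_subgraph V' E' L' G \<longrightarrow> card E' + card L' \<le> 2 * card V')"

definition remove_edge :: "'e \<Rightarrow> ('v, 'e, 'l) looped_graph \<Rightarrow> ('v, 'e, 'l) looped_graph" where
  "remove_edge e G = G\<lparr>edges := edges G - {e}\<rparr>"

definition remove_loop :: "'l \<Rightarrow> ('v, 'e, 'l) looped_graph \<Rightarrow> ('v, 'e, 'l) looped_graph" where
  "remove_loop l G = G\<lparr>loops := loops G - {l}\<rparr>"


text \<open>Here \<open>len e\<close> is the \<^emph>\<open>squared\<close> length of the bar \<open>e\<close>.\<close>

definition bar_slider_framework ::
    "('v, 'e, 'l) looped_graph \<Rightarrow> ('e \<Rightarrow> real) \<Rightarrow> ('l \<Rightarrow> real^2) \<Rightarrow> ('l \<Rightarrow> real) \<Rightarrow> bool" where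
  "bar_slider_framework G len nrm s \<longleftrightarrow>
     wf_looped_graph G \<and> (\<forall>e\<in>edges G. len e > 0) \<and> (\<forall>l\<in>loops G. nrm l \<noteq> 0)"

definition configuration_space ::
    "('v, 'e, 'l) looped_graph \<Rightarrow> ('e \<Rightarrow> real) \<Rightarrow> ('l \<Rightarrow> real^2) \<Rightarrow> ('l \<Rightarrow> real)
      \<Rightarrow> (real^2^('v::finite)) set" where
  "configuration_space G len nrm s =
     {p. (\<forall>e\<in>edges G. \<forall>i j. ends G e = {i, j} \<longrightarrow>
            (norm (vec_nth p i - vec_nth p j))\<^sup>2 = len e) \<and>
         (\<forall>l\<in>loops G. inner (vec_nth p (base G l)) (nrm l) = s l)}"

definition pinned ::
    "('v, 'e, 'l) looped_graph \<Rightarrow> ('e \<Rightarrow> real) \<Rightarrow> ('l \<Rightarrow> real^2) \<Rightarrow> ('l \<Rightarrow> real)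
      \<Rightarrow> real^2^('v::finite) \<Rightarrow> bool" where
  "pinned G len nrm s p \<longleftrightarrow> p isolated_in configuration_space G len nrm s"

definition minimally_pinned ::
    "('v, 'e, 'l) looped_graph \<Rightarrow> ('e \<Rightarrow> real) \<Rightarrow> ('l \<Rightarrow> real^2) \<Rightarrow> ('l \<Rightarrow> real)
      \<Rightarrow> real^2^('v::finite) \<Rightarrow> bool" where
  "minimally_pinned G len nrm s p \<longleftrightarrow>
     pinned G len nrm s p \<and>
     (\<forall>e\<in>edges G. \<not> pinned (remove_edge e G) len nrm s p) \<and>
     (\<forall>l\<in>loops G. \<not> pinned (remove_loop l G) len nrm s p)"


definition other_end :: "('v, 'e, 'l) looped_graph \<Rightarrow> 'e \<Rightarrow> 'v \<Rightarrow> 'v" where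
  "other_end G e v = (THE w. ends G e = {v, w})"

text \<open>
  The entries of the pinned rigidity matrix are taken in an arbitrary commutative ring, so that
  both real values and formal variables can be plugged in: \<open>x v k\<close> is the \<open>k\<close>-th coordinate of
  the point of \<open>v\<close>, and \<open>y l k\<close> the \<open>k\<close>-th coordinate of the normal of \<open>l\<close>.  Rows are indexed by
  \<open>edges G <+> loops G\<close>, and column \<open>(v, k)\<close> is the \<open>k\<close>-th column of the vertex \<open>v\<close>.
\<close>

fun rigidity_entry ::
    "('v, 'e, 'l) looped_graph \<Rightarrow> ('v \<Rightarrow> 2 \<Rightarrow> 'r::comm_ring_1) \<Rightarrow> ('l \<Rightarrow> 2 \<Rightarrow> 'r)
      \<Rightarrow> 'e + 'l \<Rightarrow> 'v \<times> 2 \<Rightarrow> 'r" where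
  "rigidity_entry G x y (Inl e) (v, k) =
     (if v \<in> ends G e then x v k - x (other_end G e v) k else 0)"
| "rigidity_entry G x y (Inr l) (v, k) = (if v = base G l then y l k else 0)"

definition rigidity_rows :: "('v, 'e, 'l) looped_graph \<Rightarrow> ('e + 'l) set" where
  "rigidity_rows G = edges G <+> loops G"

definition rigidity_rank ::
    "('v, 'e, 'l) looped_graph \<Rightarrow> real^2^('v::finite) \<Rightarrow> ('l \<Rightarrow> real^2) \<Rightarrow> nat" where
  "rigidity_rank G p nrm =
     dim ((\<lambda>r. (\<chi> c. rigidity_entry G (\<lambda>v. vec_nth (vec_nth p v)) (\<lambda>l. vec_nth (nrm l)) r c)
             :: real^('v \<times> 2)) ` rigidity_rows G)"

text \<open>
  Real polynomials in the formal variables are finitely supported maps from monomials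
  \<open>('v, 'l) coord_var \<Rightarrow>\<^sub>0 nat\<close> to coefficients, with the convolution product.
\<close>

datatype ('v, 'l) coord_var = Pos 'v 2 | Nrm 'l 2

type_synonym ('v, 'l) coord_poly = "(('v, 'l) coord_var \<Rightarrow>\<^sub>0 nat) \<Rightarrow>\<^sub>0 real"

definition Var :: "('v, 'l) coord_var \<Rightarrow> ('v, 'l) coord_poly" where
  "Var t = Poly_Mapping.single (Poly_Mapping.single t 1) 1"

text \<open>The \<open>0 \<times> 0\<close> minor is \<open>1\<close>, so the maximum below is over a nonempty set.\<close>

definition generic_rigidity_rank :: "('v::finite, 'e, 'l) looped_graph \<Rightarrow> nat" where
  "generic_rigidity_rank G =
     Max {r. \<exists>\<rho> \<gamma>. inj_on \<rho> {..<r} \<and> \<rho> ` {..<r} \<subseteq> rigidity_rows G \<and> inj_on \<gamma> {..<r} \<and>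
            Determinant.det (Matrix.mat r r (\<lambda>(i, j).
              rigidity_entry G (\<lambda>v k. Var (Pos v k)) (\<lambda>l k. Var (Nrm l k)) (\<rho> i) (\<gamma> j)))
            \<noteq> (0 :: ('v, 'l) coord_poly)}"

definition generic_realization ::
    "('v, 'e, 'l) looped_graph \<Rightarrow> ('l \<Rightarrow> real^2) \<Rightarrow> real^2^('v::finite) \<Rightarrow> bool" where
  "generic_realization G nrm p \<longleftrightarrow> rigidity_rank G p nrm = generic_rigidity_rank G"

end

(*
  Rigidity.  The rows of the rigidity matrix are, up to a factor, the gradients of the constraints.
  If they span, the realization is isolated.  If the rank at p is maximal but less than 2n, the
  constant rank theorem gives a curve of realizations through p.  Genericity makes the rank at p
  maximal, so p is minimally pinned iff the rows form a basis; restricting the basis to the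
  coordinates of a vertex set, and using that the edge rows are orthogonal to the rigid motions,
  gives the looped-Laman counts.

  Combinatorics.  It remains to find one realization of full rank for a looped-Laman graph.  First
  relax the edge rows to direction networks, where the edge ij has the row d(e_i - e_j) with a free
  direction d.  By Rado's theorem the directions can be chosen (even along the axes) with independent
  rows whenever every vertex set C carries at most 2|C| edges and loops, and at most 2|C| - 2 edges
  in the absence of loops.  This still holds for the edges of a looped-Laman graph after one of them
  is doubled, so for generic directions the network has a solution in which no edge collapses.
  Rotating it by a right angle gives the realization.
*)

theory Submission
  imports Defs
begin

section \<open>Independent families and Rado's theorem\<close>

text \<open>Rigidity rows cannot be chosen one at a time, since all edges share the coordinates of
  \<open>p\<close>. In a direction network each edge row ranges freely over a plane that depends
  only on the edge, and this is what makes a matroid transversal theorem applicable. The price is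
  that solutions may collapse edges; with the loop rows included, an independent network with 2n
  rows even has only the zero solution. So the network is solved for the edge rows alone, while the
  loops keep their directions as normals. The unit between the bound 2|C| - 3 of the Laman count and
  the bound 2|C| - 2 pays for the doubled edge: if the copy is independent of the rest, some
  solution of the original edge rows does not collapse that edge. Generic directions need no measure
  or topology: each condition fails only finitely often on a line through a point where it holds, so
  finitely many conditions can be met at once. Genericity is assumed for the whole framework only
  and is not inherited when a constraint is deleted; there the rank is maximal because the remaining
  rows are independent.\<close>

definition indep_family :: "('i \<Rightarrow> 'a::real_vector) \<Rightarrow> 'i set \<Rightarrow> bool" where
  "indep_family f J \<longleftrightarrow> inj_on f J \<and> independent (f ` J)"

text \<open>Indices matter because parallel edges or loops may have equal rows, which must count as
  a dependence: equal members give the relation with coefficients 1 and -1.\<close>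

lemma indep_family_iff:
  assumes "finite J"
  shows "indep_family f J \<longleftrightarrow> (\<forall>c. (\<Sum>i\<in>J. c i *\<^sub>R f i) = 0 \<longrightarrow> (\<forall>i\<in>J. c i = 0))"
proof
  assume f: "indep_family f J"
  show "\<forall>c. (\<Sum>i\<in>J. c i *\<^sub>R f i) = 0 \<longrightarrow> (\<forall>i\<in>J. c i = 0)"
  proof (intro allI impI ballI)
    fix c i assume 0: "(\<Sum>i\<in>J. c i *\<^sub>R f i) = 0" and i: "i \<in> J"
    have inj: "inj_on f J" using f by (simp add: indep_family_def)
    have "(\<Sum>x\<in>f ` J. c (inv_into J f x) *\<^sub>R x) = (\<Sum>i\<in>J. c i *\<^sub>R f i)"
      by (subst sum.reindex[OF inj]) (auto intro!: sum.cong simp: inj)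
    then have "c (inv_into J f (f i)) = 0"
      using f 0 i assms unfolding indep_family_def
      by (intro independentD[where s = "f ` J" and t = "f ` J" and u = "\<lambda>x. c (inv_into J f x)"]) auto
    then show "c i = 0" using inj i by simp
  qed
next
  assume *: "\<forall>c. (\<Sum>i\<in>J. c i *\<^sub>R f i) = 0 \<longrightarrow> (\<forall>i\<in>J. c i = 0)"
  have inj: "inj_on f J"
  proof (rule inj_onI, rule ccontr)
    fix x y assume xy: "x \<in> J" "y \<in> J" "f x = f y" "x \<noteq> y"
    let ?c = "\<lambda>i. if i = x then 1 else if i = y then -1 else (0::real)"
    have "(\<Sum>i\<in>J. ?c i *\<^sub>R f i) = (\<Sum>i\<in>{x,y}. ?c i *\<^sub>R f i)"
      using xy assms by (intro sum.mono_neutral_right) auto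
    also have "\<dots> = 0" using xy by simp
    finally have "?c x = 0" using *[rule_format, of ?c x] xy(1) by blast
    then show False by simp
  qed
  moreover have "independent (f ` J)"
    unfolding dependent_finite[OF finite_imageI[OF assms]]
  proof safe
    fix u x assume s: "(\<Sum>v\<in>f ` J. u v *\<^sub>R v) = 0" "x \<in> J" "u (f x) \<noteq> 0"
    have "(\<Sum>i\<in>J. u (f i) *\<^sub>R f i) = 0"
      using s(1) by (simp add: sum.reindex[OF inj])
    then show False using *[rule_format, of "\<lambda>i. u (f i)" x] s by blast
  qed
  ultimately show "indep_family f J" by (simp add: indep_family_def)
qed

lemma indep_family_card_eq_dim:
  fixes f :: "'i \<Rightarrow> 'a::euclidean_space"
  assumes "indep_family f J"
  shows "dim (f ` J) = card J"
  using assms by (simp add: indep_family_def dim_eq_card_independent card_image)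

lemma indep_family_if_card_le_dim:
  fixes f :: "'i \<Rightarrow> 'a::euclidean_space"
  assumes "finite J" "card J \<le> dim (f ` J)"
  shows "indep_family f J"
proof -
  have "dim (f ` J) \<le> card (f ` J)" using assms by (simp add: dim_le_card')
  moreover have "card (f ` J) \<le> card J" using assms(1) by (rule card_image_le)
  ultimately have "card (f ` J) = card J" "card (f ` J) \<le> dim (f ` J)" using assms by auto
  moreover have "independent (f ` J)" if "card (f ` J) \<le> dim (f ` J)"
    using that assms(1) by (intro card_le_dim_spanning[of "f ` J" "f ` J"]) (auto intro: span_base)
  ultimately show ?thesis using assms(1) by (simp add: indep_family_def eq_card_imp_inj_on)
qed

lemma indep_family_subset: "indep_family f J \<Longrightarrow> I \<subseteq> J \<Longrightarrow> indep_family f I"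
  unfolding indep_family_def
  using inj_on_subset[of f J I] independent_mono[of "f ` J" "f ` I"] by auto

lemma indep_family_linear_image:
  assumes "linear L" "inj L" "finite J"
  shows "indep_family (\<lambda>i. L (f i)) J \<longleftrightarrow> indep_family f J"
proof -
  have "(\<Sum>i\<in>J. c i *\<^sub>R L (f i)) = 0 \<longleftrightarrow> (\<Sum>i\<in>J. c i *\<^sub>R f i) = 0" for c
  proof -
    have "(\<Sum>i\<in>J. c i *\<^sub>R L (f i)) = L (\<Sum>i\<in>J. c i *\<^sub>R f i)"
      using assms(1) by (simp add: linear_sum linear_scale)
    moreover have "L x = 0 \<longleftrightarrow> x = 0" for x
      using injD[OF assms(2), of x 0] linear_0[OF assms(1)] by auto
    ultimately show ?thesis by simp
  qed
  then show ?thesis by (simp add: indep_family_iff[OF assms(3)])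
qed

text \<open>Rado's theorem for linear matroids.  As long as some set has two elements, one of the two can be
  discarded: if both deletions violated the condition, submodularity of the dimension would
  contradict it for the original sets.\<close>

lemma rado_transversal:
  fixes A :: "'i \<Rightarrow> 'a::euclidean_space set"
  assumes "finite J" and "\<And>i. i \<in> J \<Longrightarrow> finite (A i)"
    and "\<And>I. I \<subseteq> J \<Longrightarrow> card I \<le> dim (\<Union>i\<in>I. A i)"
  shows "\<exists>f. (\<forall>i\<in>J. f i \<in> A i) \<and> indep_family f J"
  using assms(2,3)
proof (induction "\<Sum>i\<in>J. card (A i)" arbitrary: A rule: less_induct)
  case less
  have ne: "A i \<noteq> {}" if "i \<in> J" for i
    using less.prems(2)[of "{i}"] that by auto
  show ?case
  proof (cases "\<forall>i\<in>J. card (A i) \<le> 1")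
    case True
    define f where "f i = (SOME x. x \<in> A i)" for i
    have Ai: "A i = {f i}" if "i \<in> J" for i
    proof -
      have "card (A i) \<noteq> 0" using ne[OF that] less.prems(1)[OF that] by simp
      then have "card (A i) = 1" using True that by (simp add: le_antisym)
      then obtain z where z: "A i = {z}" by (rule card_1_singletonE)
      then have "f i = z" by (simp add: f_def)
      then show ?thesis using z by simp
    qed
    then have "(\<Union>i\<in>J. A i) = f ` J" by auto
    then have "indep_family f J"
      using less.prems(2)[of J] assms(1) by (auto intro: indep_family_if_card_le_dim)
    then show ?thesis using Ai by auto
  next
    case False
    then obtain k where k: "k \<in> J" "card (A k) > 1" by force
    then have "\<not> (\<forall>x\<in>A k. \<forall>y\<in>A k. x = y)"
      using card_le_Suc0_iff_eq[OF less.prems(1)[OF k(1)]] by simp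
    then obtain x y where xy: "x \<in> A k" "y \<in> A k" "x \<noteq> y" by blast
    define B where "B z = A(k := A k - {z})" for z
    have smaller: "(\<Sum>i\<in>J. card (B z i)) < (\<Sum>i\<in>J. card (A i))" if "z \<in> A k" for z
    proof (rule sum_strict_mono_ex1)
      show "\<forall>i\<in>J. card (B z i) \<le> card (A i)"
        using less.prems(1) by (auto simp: B_def intro!: card_mono)
      show "\<exists>i\<in>J. card (B z i) < card (A i)"
        using k that less.prems(1)
        by (intro bexI[of _ k]) (auto simp: B_def intro!: psubset_card_mono)
    qed (rule assms(1))
    have sub: "B z i \<subseteq> A i" for z i by (auto simp: B_def)
    have step: ?thesis if "z \<in> A k" "\<And>I. I \<subseteq> J \<Longrightarrow> card I \<le> dim (\<Union>i\<in>I. B z i)" for z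
    proof -
      have "\<exists>f. (\<forall>i\<in>J. f i \<in> B z i) \<and> indep_family f J"
        using less.prems(1) that
        by (intro less.hyps smaller) (auto intro: finite_subset[OF sub])
      then show ?thesis using sub by blast
    qed
    \<comment> \<open>A violating set must contain \<open>k\<close>, since all other sets are
      unchanged. Here \<open>I\<close> is that set with \<open>k\<close> dropped, which turns the
      strict inequality into \<open>\<le>\<close>.\<close>
    have viol: "\<exists>I. I \<subseteq> J - {k} \<and> dim ((\<Union>i\<in>I. A i) \<union> (A k - {z})) \<le> card I"
      if z: "\<not> (\<forall>I. I \<subseteq> J \<longrightarrow> card I \<le> dim (\<Union>i\<in>I. B z i))" for z
    proof -
      from z have "\<exists>I. I \<subseteq> J \<and> dim (\<Union>i\<in>I. B z i) < card I"
        by (simp only: not_all not_imp not_le)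
      then obtain I where I: "I \<subseteq> J" "dim (\<Union>i\<in>I. B z i) < card I" by (elim exE conjE) (rule that)
      have "k \<in> I"
      proof (rule ccontr)
        assume "k \<notin> I"
        then have "(\<Union>i\<in>I. B z i) = (\<Union>i\<in>I. A i)" by (auto simp: B_def split: if_splits)
        then show False using I less.prems(2)[of I] by simp
      qed
      then have U: "(\<Union>i\<in>I. B z i) = (\<Union>i\<in>I-{k}. A i) \<union> (A k - {z})"
        by (auto simp: B_def split: if_splits)
      have "finite I" using I assms(1) finite_subset by blast
      then have "card (I - {k}) = card I - 1" using \<open>k \<in> I\<close> by simp
      then show ?thesis using I U by (intro exI[of _ "I - {k}"]) auto
    qed
    show ?thesis
    proof (rule ccontr)
      assume contra: "\<not> ?thesis"
      have "\<not> (\<forall>I. I \<subseteq> J \<longrightarrow> card I \<le> dim (\<Union>i\<in>I. B x i))"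
      proof
        assume "\<forall>I. I \<subseteq> J \<longrightarrow> card I \<le> dim (\<Union>i\<in>I. B x i)"
        then have "\<exists>f. (\<forall>i\<in>J. f i \<in> A i) \<and> indep_family f J"
          by (intro step[OF xy(1)]) simp
        with contra show False by contradiction
      qed
      from viol[OF this] obtain I1 where I1: "I1 \<subseteq> J - {k}"
        "dim ((\<Union>i\<in>I1. A i) \<union> (A k - {x})) \<le> card I1"
        by (elim exE conjE) (rule that)
      have "\<not> (\<forall>I. I \<subseteq> J \<longrightarrow> card I \<le> dim (\<Union>i\<in>I. B y i))"
      proof
        assume "\<forall>I. I \<subseteq> J \<longrightarrow> card I \<le> dim (\<Union>i\<in>I. B y i)"
        then have "\<exists>f. (\<forall>i\<in>J. f i \<in> A i) \<and> indep_family f J"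
          by (intro step[OF xy(2)]) simp
        with contra show False by contradiction
      qed
      from viol[OF this] obtain I2 where I2: "I2 \<subseteq> J - {k}"
        "dim ((\<Union>i\<in>I2. A i) \<union> (A k - {y})) \<le> card I2"
        by (elim exE conjE) (rule that)
      let ?S = "span ((\<Union>i\<in>I1. A i) \<union> (A k - {x}))"
      let ?T = "span ((\<Union>i\<in>I2. A i) \<union> (A k - {y}))"
      have fin: "finite I1" "finite I2"
        using finite_subset[OF I1(1)] finite_subset[OF I2(1)] assms(1) by simp_all
      have "dim {s + t |s t. s \<in> ?S \<and> t \<in> ?T} + dim (?S \<inter> ?T) = dim ?S + dim ?T"
        by (rule dim_sums_Int) auto
      \<comment> \<open>As \<open>x \<noteq> y\<close>, the two reduced sets still cover
        \<open>A k\<close> together. So the sum of the spans must accommodate one index more than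
        \<open>I1 \<union> I2\<close>, and this surplus is the contradiction.\<close>
      moreover have "card (insert k (I1 \<union> I2)) \<le> dim {s + t |s t. s \<in> ?S \<and> t \<in> ?T}"
      proof (rule order.trans)
        show "card (insert k (I1 \<union> I2)) \<le> dim (\<Union>i\<in>insert k (I1 \<union> I2). A i)"
          using I1 I2 k by (intro less.prems(2)) auto
        have "(\<Union>i\<in>insert k (I1 \<union> I2). A i) \<subseteq> ?S \<union> ?T"
        proof -
          have "A k \<subseteq> (A k - {x}) \<union> (A k - {y})" using xy by auto
          moreover have "A k - {x} \<subseteq> ?S" "A k - {y} \<subseteq> ?T" "(\<Union>i\<in>I1. A i) \<subseteq> ?S" "(\<Union>i\<in>I2. A i) \<subseteq> ?T"
            by (auto intro: span_base)
          ultimately show ?thesis by blast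
        qed
        also have "\<dots> \<subseteq> {s + t |s t. s \<in> ?S \<and> t \<in> ?T}"
        proof
          fix v assume "v \<in> ?S \<union> ?T"
          then show "v \<in> {s + t |s t. s \<in> ?S \<and> t \<in> ?T}"
          proof
            assume "v \<in> ?S"
            then have "v = v + 0 \<and> v \<in> ?S \<and> 0 \<in> ?T" by (simp add: span_zero)
            then show ?thesis by blast
          next
            assume "v \<in> ?T"
            then have "v = 0 + v \<and> 0 \<in> ?S \<and> v \<in> ?T" by (simp add: span_zero)
            then show ?thesis by blast
          qed
        qed
        finally show "dim (\<Union>i\<in>insert k (I1 \<union> I2). A i) \<le> dim {s + t |s t. s \<in> ?S \<and> t \<in> ?T}"
          by (rule dim_subset)
      qed
      moreover have "card (I1 \<inter> I2) \<le> dim (?S \<inter> ?T)"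
      proof (rule order.trans)
        show "card (I1 \<inter> I2) \<le> dim (\<Union>i\<in>I1 \<inter> I2. A i)"
          using I1 I2 by (intro less.prems(2)) auto
        show "dim (\<Union>i\<in>I1 \<inter> I2. A i) \<le> dim (?S \<inter> ?T)"
          by (intro dim_subset) (auto intro: span_base)
      qed
      moreover have "card (insert k (I1 \<union> I2)) = Suc (card (I1 \<union> I2))"
        using fin I1 I2 by (subst card_insert_disjoint) auto
      moreover have "card I1 + card I2 = card (I1 \<union> I2) + card (I1 \<inter> I2)"
        using fin by (rule card_Un_Int)
      ultimately show False using I1(2) I2(2) unfolding dim_span by linarith
    qed
  qed
qed

section \<open>Independence along a line\<close>

text \<open>The members at \<open>t0\<close> are completed to a basis by vectors that do not move
  with \<open>t\<close>. The determinant of the resulting square matrix is a polynomial in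
  \<open>t\<close> that is nonzero at \<open>t0\<close>, hence has finitely many zeros.\<close>

lemma line_independence_cofinite:
  fixes X Y :: "'i \<Rightarrow> real^'n"
  assumes "finite J" and indep: "indep_family (\<lambda>i. X i + t0 *\<^sub>R Y i) J"
  shows "finite {t. \<not> indep_family (\<lambda>i. X i + t *\<^sub>R Y i) J}"
proof -
  define f where "f i = X i + t0 *\<^sub>R Y i" for i
  have f: "inj_on f J" "independent (f ` J)"
    using indep by (simp_all add: indep_family_def f_def[abs_def])
  obtain B where B: "f ` J \<subseteq> B" "independent B" "UNIV \<subseteq> span B"
    by (rule maximal_independent_subset_extend[OF subset_UNIV f(2)])
  have finB: "finite B" using B(2) by (rule independent_imp_finite)
  have "card B = CARD('n)"
    using B(2,3) dim_eq_card_independent[OF B(2)] dim_eq_full[of B] by (simp add: top.extremum_unique)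
  \<comment> \<open>Indexing the basis by the coordinates makes its members the rows of a square
    matrix.\<close>
  then obtain \<beta> :: "'n \<Rightarrow> (real^'n)" where \<beta>: "bij_betw \<beta> UNIV B"
    using finite_same_card_bij[of "UNIV :: 'n set" B] finB by auto
  define g where "g = inv_into J f"
  \<comment> \<open>A basis vector taken from the family moves along its line; an added one has
    velocity 0.\<close>
  define U where "U n = (if \<beta> n \<in> f ` J then X (g (\<beta> n)) else \<beta> n)" for n
  define W where "W n = (if \<beta> n \<in> f ` J then Y (g (\<beta> n)) else 0)" for n
  define A :: "real \<Rightarrow> real^'n^'n" where "A t = (\<chi> n. U n + t *\<^sub>R W n)" for t
  define q :: "real poly" where
    "q = (\<Sum>p | p permutes (UNIV :: 'n set). [:of_int (sign p):] *
            (\<Prod>n\<in>UNIV. [:vec_nth (U n) (p n), vec_nth (W n) (p n):]))"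
  have q: "Determinants.det (A t) = poly q t" for t
    by (simp add: Determinants.det_def q_def A_def poly_sum poly_prod)
  have row: "Finite_Cartesian_Product.row n (A t) = U n + t *\<^sub>R W n" for n t
    by (simp add: Finite_Cartesian_Product.vec_eq_iff A_def Finite_Cartesian_Product.row_def)
  have det_iff: "Determinants.det (A t) \<noteq> 0 \<longleftrightarrow> indep_family (\<lambda>n. U n + t *\<^sub>R W n) UNIV" for t
    unfolding indep_family_iff[OF finite] invertible_det_nz[symmetric] invertible_right_inverse
      matrix_right_invertible_independent_rows
    by (simp add: row scalar_mult_eq_scaleR)
  have "U n + t0 *\<^sub>R W n = \<beta> n" for n
    using f_inv_into_f[of "\<beta> n" f J] by (auto simp: U_def W_def g_def f_def)
  moreover have "indep_family \<beta> UNIV"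
    using \<beta> B(2) by (auto simp: indep_family_def bij_betw_def)
  ultimately have "poly q t0 \<noteq> 0" using det_iff[of t0] by (simp add: q)
  then have "q \<noteq> 0" by auto
  have good: "indep_family (\<lambda>i. X i + t *\<^sub>R Y i) J" if "poly q t \<noteq> 0" for t
  proof -
    define h where "h i = inv_into UNIV \<beta> (f i)" for i
    have h: "\<beta> (h i) = f i" if "i \<in> J" for i
      using \<beta> B(1) that by (auto simp: h_def bij_betw_def intro!: f_inv_into_f)
    have UW: "U (h i) + t *\<^sub>R W (h i) = X i + t *\<^sub>R Y i" if "i \<in> J" for i
      using h[OF that] that f(1) by (simp add: U_def W_def g_def)
    have inj_h: "inj_on h J"
    proof (rule inj_onI)
      fix i j assume "i \<in> J" "j \<in> J" "h i = h j"
      then show "i = j" using h[of i] h[of j] inj_onD[OF f(1)] by simp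
    qed
    have *: "indep_family (\<lambda>n. U n + t *\<^sub>R W n) (h ` J)"
      using det_iff[of t] that by (auto simp: q intro: indep_family_subset)
    have "inj_on (\<lambda>i. X i + t *\<^sub>R Y i) J"
    proof (rule inj_onI)
      fix i j assume ij: "i \<in> J" "j \<in> J" "X i + t *\<^sub>R Y i = X j + t *\<^sub>R Y j"
      have "inj_on (\<lambda>n. U n + t *\<^sub>R W n) (h ` J)" using * by (simp add: indep_family_def)
      then have "h i = h j" by (rule inj_onD) (use ij UW in auto)
      then show "i = j" using inj_h ij by (auto dest: inj_onD)
    qed
    moreover have "(\<lambda>i. X i + t *\<^sub>R Y i) ` J = (\<lambda>n. U n + t *\<^sub>R W n) ` (h ` J)"
      unfolding image_image by (intro image_cong) (simp_all add: UW)
    ultimately show ?thesis using * by (simp add: indep_family_def)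
  qed
  from \<open>q \<noteq> 0\<close> have "finite {t. poly q t = 0}" by (rule poly_roots_finite)
  moreover have "{t. \<not> indep_family (\<lambda>i. X i + t *\<^sub>R Y i) J} \<subseteq> {t. poly q t = 0}"
    using good by auto
  ultimately show ?thesis by (rule rev_finite_subset)
qed

text \<open>Plays the part of intersecting nonempty Zariski-open sets. On the line joining a point
  good for the earlier conditions to one good for the new condition, only finitely many parameters
  are bad, and the reals are infinite.\<close>

lemma cofinite_on_lines_common_point:
  fixes L :: "'t \<Rightarrow> 't \<Rightarrow> real \<Rightarrow> 't"
  assumes "finite K" "S \<noteq> {}"
    and nonempty: "\<And>k. k \<in> K \<Longrightarrow> \<exists>t\<in>S. P k t"
    and closed: "\<And>t u \<tau>. t \<in> S \<Longrightarrow> u \<in> S \<Longrightarrow> L t u \<tau> \<in> S"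
    and cofinite: "\<And>k t u. k \<in> K \<Longrightarrow> t \<in> S \<Longrightarrow> u \<in> S \<Longrightarrow> P k t \<or> P k u \<Longrightarrow> finite {\<tau>. \<not> P k (L t u \<tau>)}"
  shows "\<exists>t\<in>S. \<forall>k\<in>K. P k t"
  using assms(1) nonempty cofinite
proof (induction K rule: finite_induct)
  case empty
  then show ?case using assms(2) by auto
next
  case (insert k K)
  obtain t where t: "t \<in> S" "\<And>j. j \<in> K \<Longrightarrow> P j t" using insert by blast
  obtain u where u: "u \<in> S" "P k u" using insert by blast
  have "finite (\<Union>j\<in>insert k K. {\<tau>. \<not> P j (L t u \<tau>)})"
    using t u insert.hyps insert.prems by (intro finite_UN_I) auto
  then obtain \<tau> where "\<tau> \<notin> (\<Union>j\<in>insert k K. {\<tau>. \<not> P j (L t u \<tau>)})"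
    using ex_new_if_finite[OF infinite_UNIV_char_0] by blast
  then show ?case using closed[OF t(1) u(1), of \<tau>] by blast
qed

section \<open>Incidence vectors of sparse looped multigraphs\<close>

text \<open>A loop is treated as an edge whose other end is grounded: \<open>None\<close>
  contributes zero. The abstract index allows parallel copies, including artificial ones.\<close>

definition incidence_vector ::
    "('i \<Rightarrow> 'v) \<Rightarrow> ('i \<Rightarrow> 'v option) \<Rightarrow> 'i \<Rightarrow> real^2 \<Rightarrow> real^2^('v::finite)" where
  "incidence_vector u w i d =
     axis (u i) d - (case w i of None \<Rightarrow> 0 | Some v \<Rightarrow> axis v d)"

lemma inner_incidence_vector:
  "inner (incidence_vector u w i d) h =
     inner d (vec_nth h (u i) - (case w i of None \<Rightarrow> 0 | Some v \<Rightarrow> vec_nth h v))"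
  by (cases "w i") (simp_all add: incidence_vector_def inner_diff_left inner_diff_right inner_axis')

lemma linear_axis: "linear (axis v :: 'a::real_vector \<Rightarrow> 'a^'v::finite)"
  by (rule linearI) (auto simp: axis_def Finite_Cartesian_Product.vec_eq_iff)

lemma linear_incidence_vector: "linear (incidence_vector u w i)"
proof (cases "w i")
  case None
  then show ?thesis by (simp add: incidence_vector_def[abs_def] linear_axis)
next
  case (Some v)
  then show ?thesis
    unfolding incidence_vector_def[abs_def] by (simp add: linear_compose_sub linear_axis)
qed

context
  fixes u :: "'i \<Rightarrow> 'v::finite" and w :: "'i \<Rightarrow> 'v option" and J :: "'i set"
  assumes finite_J: "finite J"
    and sparse: "\<And>I C. I \<subseteq> J \<Longrightarrow> (\<forall>i\<in>I. insert (u i) (set_option (w i)) \<subseteq> C) \<Longrightarrow>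
      card I \<le> 2 * card C"
    and sparse_loopfree: "\<And>I C. I \<subseteq> J \<Longrightarrow> (\<forall>i\<in>I. insert (u i) (set_option (w i)) \<subseteq> C) \<Longrightarrow>
      (\<forall>i\<in>I. w i \<noteq> None) \<Longrightarrow> C \<noteq> {} \<Longrightarrow> card I + 2 \<le> 2 * card C"
begin

text \<open>This is Rado's condition. A vector orthogonal to all incidence vectors of
  \<open>I\<close> is constant on each component of the graph \<open>I\<close> and zero on
  components with a loop, so the complement has dimension at most twice the number of loop-free
  components. Summing the sparsity bounds over the components shows that \<open>card I\<close> fits
  into what remains.\<close>

lemma card_le_dim_incidence_span:
  assumes I: "I \<subseteq> J"
  shows "card I \<le> dim (\<Union>i\<in>I. incidence_vector u w i ` Basis)"
proof -
  define W where "W = (\<Union>i\<in>I. incidence_vector u w i ` Basis)"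
  define K where "K = {h \<in> UNIV. \<forall>x\<in>span W. Linear_Algebra.orthogonal x h}"
  define E where "E = {(u i, v) | i v. i \<in> I \<and> w i = Some v}"
  \<comment> \<open>Connectivity by the edges of \<open>I\<close>: \<open>Q\<close> is the set of
    components, \<open>F\<close> those without a loop, isolated vertices included.\<close>
  define R where "R = (E \<union> E\<inverse>)\<^sup>*"
  define cl where "cl a = R `` {a}" for a
  define Q where "Q = UNIV // R"
  define F where "F = {C \<in> Q. \<forall>i\<in>I. u i \<in> C \<longrightarrow> w i \<noteq> None}"
  have "sym (E \<union> E\<inverse>)" by (auto simp: sym_def)
  then have R: "equiv UNIV R"
    unfolding R_def by (intro equivI) (auto simp: refl_on_def intro: sym_rtrancl trans_rtrancl)
  have in_cl: "a \<in> C \<longleftrightarrow> cl a = C" if C: "C \<in> Q" for a C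
  proof -
    obtain b where b: "C = R `` {b}" using C unfolding Q_def by (elim quotientE)
    have "a \<in> C \<longleftrightarrow> R `` {b} = R `` {a}"
      unfolding b eq_equiv_class_iff[OF R UNIV_I UNIV_I] by simp
    then show ?thesis by (auto simp: b cl_def)
  qed
  have cl_Q: "cl a \<in> Q" for a by (simp add: cl_def Q_def quotientI)
  have edge: "v \<in> C" if "i \<in> I" "w i = Some v" "u i \<in> C" "C \<in> Q" for i v C
  proof -
    have "(u i, v) \<in> R" unfolding R_def E_def using that by (intro r_into_rtrancl) auto
    then have "cl (u i) = cl v" unfolding cl_def by (rule equiv_class_eq[OF R])
    then show ?thesis using that in_cl by blast
  qed
  have fin: "finite Q" "finite F" by (auto simp: Q_def F_def)
  have finI: "finite I" using I finite_J finite_subset by blast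

  \<comment> \<open>Orthogonality for both axis directions forces equal vectors at the two ends of
    an edge and the zero vector at a loop.\<close>
  have eqn: "vec_nth h (u i) = (case w i of None \<Rightarrow> 0 | Some v \<Rightarrow> vec_nth h v)"
    if h: "h \<in> K" and i: "i \<in> I" for h :: "real^2^'v" and i
  proof -
    have "inner b (vec_nth h (u i) - (case w i of None \<Rightarrow> 0 | Some v \<Rightarrow> vec_nth h v)) = 0"
      if b: "b \<in> Basis" for b
    proof -
      have "incidence_vector u w i b \<in> span W"
        unfolding W_def using i b by (intro span_base) auto
      then have "inner (incidence_vector u w i b) h = 0"
        using h unfolding K_def Linear_Algebra.orthogonal_def by blast
      then show ?thesis by (simp only: inner_incidence_vector)
    qed
    then have "vec_nth h (u i) - (case w i of None \<Rightarrow> 0 | Some v \<Rightarrow> vec_nth h v) = 0"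
      by (intro euclidean_all_zero_iff[THEN iffD1]) (simp add: inner_commute)
    then show ?thesis by simp
  qed
  have const: "vec_nth h a = vec_nth h b" if h: "h \<in> K" and ab: "(a, b) \<in> R" for h a b
    using ab unfolding R_def
  proof (induction rule: rtrancl_induct)
    case (step y z)
    then have "vec_nth h y = vec_nth h z" using eqn[OF h] by (auto simp: E_def)
    then show ?case using step by simp
  qed simp
  have zero: "vec_nth h a = 0" if h: "h \<in> K" and a: "cl a \<notin> F" for h a
  proof -
    obtain i where i: "i \<in> I" "u i \<in> cl a" "w i = None" using a cl_Q[of a] by (auto simp: F_def)
    then have "vec_nth h a = vec_nth h (u i)" by (intro const[OF h]) (simp add: cl_def)
    then show ?thesis using eqn[OF h i(1)] i(3) by simp
  qed
  \<comment> \<open>\<open>ind (C, b)\<close> is \<open>b\<close> on \<open>C\<close> and zero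
    elsewhere, which gives two generators for each loop-free component.\<close>
  define ind :: "'v set \<times> (real^2) \<Rightarrow> real^2^'v" where
    "ind = (\<lambda>(C, b). \<chi> a. if a \<in> C then b else 0)"
  define rep where "rep C = (SOME a::'v. a \<in> C)" for C
  have rep: "(a, rep (cl a)) \<in> R" for a
  proof -
    have "a \<in> cl a" using in_cl cl_Q by blast
    then have "rep (cl a) \<in> cl a" unfolding rep_def by (rule someI)
    then show ?thesis by (simp add: cl_def)
  qed
  have "K \<subseteq> span (ind ` (F \<times> Basis))"
  proof
    fix h assume h: "h \<in> K"
    have "h = (\<Sum>C\<in>F. \<Sum>b\<in>Basis. inner (vec_nth h (rep C)) b *\<^sub>R ind (C, b))"
    proof (subst Finite_Cartesian_Product.vec_eq_iff, rule allI)
      fix a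
      have "vec_nth (\<Sum>C\<in>F. \<Sum>b\<in>Basis. inner (vec_nth h (rep C)) b *\<^sub>R ind (C, b)) a =
            (\<Sum>C\<in>F. if cl a = C then (\<Sum>b\<in>Basis. inner (vec_nth h (rep C)) b *\<^sub>R b) else 0)"
        unfolding sum_component ind_def
        using in_cl by (intro sum.cong) (auto simp: F_def)
      also have "\<dots> = (\<Sum>C\<in>F. if cl a = C then vec_nth h (rep C) else 0)"
        by (simp add: euclidean_representation)
      also have "\<dots> = (if cl a \<in> F then vec_nth h (rep (cl a)) else 0)"
        using fin by simp
      also have "\<dots> = vec_nth h a" using zero[OF h] const[OF h rep] by simp
      finally show "vec_nth h a =
          vec_nth (\<Sum>C\<in>F. \<Sum>b\<in>Basis. inner (vec_nth h (rep C)) b *\<^sub>R ind (C, b)) a" by simp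
    qed
    also have "\<dots> \<in> span (ind ` (F \<times> Basis))"
      by (intro span_sum span_mul span_base) auto
    finally show "h \<in> span (ind ` (F \<times> Basis))" .
  qed
  then have "dim K \<le> card (ind ` (F \<times> (Basis :: (real^2) set)))"
    using fin by (intro dim_le_card) auto
  also have "\<dots> \<le> card (F \<times> (Basis :: (real^2) set))" using fin by (intro card_image_le) auto
  finally have dimK: "dim K \<le> 2 * card F" by (simp add: card_cartesian_product)
  have "dim K + dim (span W) = dim (UNIV :: (real^2^'v) set)"
    unfolding K_def by (intro dim_subspace_orthogonal_to_vectors) auto
  then have dims: "dim K + dim W = 2 * CARD('v)" by simp

  define IC where "IC C = {i \<in> I. u i \<in> C}" for C
  \<comment> \<open>The additional 2 for a loop-free component matches the two dimensions that it
    may contribute to \<open>K\<close>.\<close>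
  have IC: "card (IC C) + (if C \<in> F then 2 else 0) \<le> 2 * card C" if C: "C \<in> Q" for C
  proof -
    have sub: "IC C \<subseteq> J" "\<forall>i\<in>IC C. insert (u i) (set_option (w i)) \<subseteq> C"
      using I edge C by (auto simp: IC_def)
    have "C \<noteq> {}" using C in_quotient_imp_non_empty[OF R] by (simp add: Q_def)
    then show ?thesis using sparse[OF sub] sparse_loopfree[OF sub] by (auto simp: F_def IC_def)
  qed
  have "I = (\<Union>C\<in>Q. IC C)" using cl_Q in_cl by (auto simp: IC_def)
  then have "card I \<le> (\<Sum>C\<in>Q. card (IC C))" using card_UN_le[OF fin(1), of IC] by simp
  moreover have "(\<Sum>C\<in>Q. card (IC C) + (if C \<in> F then 2 else 0)) \<le> (\<Sum>C\<in>Q. 2 * card C)"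
    by (rule sum_mono) (rule IC)
  moreover have "(\<Sum>C\<in>Q. if C \<in> F then 2 else 0) = 2 * card F"
  proof -
    have "Q \<inter> {C. C \<in> F} = F" by (auto simp: F_def)
    then show ?thesis using fin by (simp add: sum.If_cases)
  qed
  moreover have "(\<Sum>C\<in>Q. card C) = CARD('v)"
  proof -
    have "card (\<Union>Q) = (\<Sum>C\<in>Q. card C)"
      using quotient_disj[OF R] by (intro card_Union_disjoint) (auto simp: pairwise_def disjnt_def Q_def)
    moreover have "\<Union>Q = UNIV" unfolding Q_def by (rule Union_quotient[OF R])
    ultimately show ?thesis by simp
  qed
  ultimately have "card I + 2 * card F \<le> 2 * CARD('v)"
    by (simp add: sum.distrib sum_distrib_left[symmetric])
  then show ?thesis using dimK dims by (simp add: W_def)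
qed

text \<open>Rado's theorem is applied to finite sets, so each index offers only the two axis
  directions; by linearity their images span the same subspace as all directions do.\<close>

lemma ex_independent_directions:
  "\<exists>t. indep_family (\<lambda>i. incidence_vector u w i (t i)) J"
proof -
  have "\<exists>f. (\<forall>i\<in>J. f i \<in> incidence_vector u w i ` Basis) \<and> indep_family f J"
    by (rule rado_transversal[OF finite_J]) (simp_all add: card_le_dim_incidence_span)
  then obtain f where f: "\<And>i. i \<in> J \<Longrightarrow> f i \<in> incidence_vector u w i ` Basis" "indep_family f J"
    by blast
  define t where "t i = (SOME d. f i = incidence_vector u w i d)" for i
  have t: "incidence_vector u w i (t i) = f i" if "i \<in> J" for i
  proof -
    have "\<exists>d. f i = incidence_vector u w i d" using f(1)[OF that] by auto
    then have "f i = incidence_vector u w i (t i)" unfolding t_def by (rule someI_ex)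
    then show ?thesis by (rule sym)
  qed
  have "inj_on (\<lambda>i. incidence_vector u w i (t i)) J \<longleftrightarrow> inj_on f J" using t by (rule inj_on_cong)
  moreover have "(\<lambda>i. incidence_vector u w i (t i)) ` J = f ` J" using t by (intro image_cong refl)
  ultimately have "indep_family (\<lambda>i. incidence_vector u w i (t i)) J"
    using f(2) by (simp add: indep_family_def)
  then show ?thesis by blast
qed

end

section \<open>Direction networks of looped-Laman graphs\<close>

text \<open>Pure reindexing: determinants and the rows of the rigidity matrix use a single
  coordinate index, the geometry uses one plane vector per vertex.\<close>

definition flatten :: "real^2^'v \<Rightarrow> real^('v::finite \<times> 2)" where
  "flatten h = (\<chi> c. vec_nth (vec_nth h (fst c)) (snd c))"

lemma linear_flatten: "linear flatten"
  by (rule linearI) (simp_all add: flatten_def Finite_Cartesian_Product.vec_eq_iff)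

lemma inj_flatten: "inj flatten"
  by (rule injI) (simp add: flatten_def Finite_Cartesian_Product.vec_eq_iff)

lemma incidence_line_independence_cofinite:
  assumes "finite J" and indep: "indep_family (\<lambda>i. incidence_vector u w i (X i + t0 *\<^sub>R Y i)) J"
  shows "finite {t. \<not> indep_family (\<lambda>i. incidence_vector u w i (X i + t *\<^sub>R Y i)) J}"
proof -
  have eq: "indep_family (\<lambda>i. incidence_vector u w i (X i + t *\<^sub>R Y i)) J \<longleftrightarrow>
      indep_family (\<lambda>i. flatten (incidence_vector u w i (X i)) +
        t *\<^sub>R flatten (incidence_vector u w i (Y i))) J" for t
  proof -
    have "flatten (incidence_vector u w i (X i)) + t *\<^sub>R flatten (incidence_vector u w i (Y i)) =
        flatten (incidence_vector u w i (X i + t *\<^sub>R Y i))" for i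
      by (simp add: linear_add linear_scale linear_flatten linear_incidence_vector)
    then show ?thesis
      by (simp add: indep_family_linear_image[OF linear_flatten inj_flatten assms(1)])
  qed
  show ?thesis using indep unfolding eq by (rule line_independence_cofinite[OF assms(1)])
qed

text \<open>A vanishing factor would put the zero vector into an independent family, so every
  \<open>c i\<close> is nonzero and can be divided out.\<close>

lemma indep_family_descale:
  assumes "finite J" "indep_family (\<lambda>i. c i *\<^sub>R f i) J"
  shows "indep_family f J"
  unfolding indep_family_iff[OF assms(1)]
proof (intro allI impI ballI)
  fix a i assume a: "(\<Sum>i\<in>J. a i *\<^sub>R f i) = 0" and i: "i \<in> J"
  have c: "c j \<noteq> 0" if "j \<in> J" for j
  proof
    assume "c j = 0"
    then have "0 \<in> (\<lambda>i. c i *\<^sub>R f i) ` J" using that by (intro image_eqI[of _ _ j]) simp_all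
    then have "dependent ((\<lambda>i. c i *\<^sub>R f i) ` J)" by (rule dependent_zero)
    then show False using assms(2) by (simp add: indep_family_def)
  qed
  have "(\<Sum>i\<in>J. (a i / c i) *\<^sub>R (c i *\<^sub>R f i)) = (\<Sum>i\<in>J. a i *\<^sub>R f i)"
    using c by (intro sum.cong) simp_all
  then have "a i / c i = 0"
    using assms(2)[unfolded indep_family_iff[OF assms(1)], rule_format, of "\<lambda>i. a i / c i" i] a i by simp
  then show "a i = 0" using c[OF i] by simp
qed

section \<open>Rows of the rigidity matrix as incidence vectors\<close>

definition row_tail :: "('v, 'e, 'l) looped_graph \<Rightarrow> 'e + 'l \<Rightarrow> 'v" where
  "row_tail G r = (case r of Inl e \<Rightarrow> (SOME v. v \<in> ends G e) | Inr l \<Rightarrow> base G l)"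

definition row_head :: "('v, 'e, 'l) looped_graph \<Rightarrow> 'e + 'l \<Rightarrow> 'v option" where
  "row_head G r = (case r of Inl e \<Rightarrow> Some (other_end G e (row_tail G r)) | Inr l \<Rightarrow> None)"

definition edge_head :: "('v, 'e, 'l) looped_graph \<Rightarrow> 'e \<Rightarrow> 'v" where
  "edge_head G e = other_end G e (row_tail G (Inl e))"

lemma row_simps [simp]:
  "row_tail G (Inr l) = base G l" "row_head G (Inr l) = None" "row_head G (Inl e) = Some (edge_head G e)"
  by (simp_all add: row_tail_def row_head_def edge_head_def)

lemma other_end_eq: "ends G e = {a, b} \<Longrightarrow> a \<noteq> b \<Longrightarrow> other_end G e a = b"
  unfolding other_end_def by (rule the_equality) (auto simp: doubleton_eq_iff)

lemma edge_ends:
  assumes "card (ends G e) = 2"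
  shows "ends G e = {row_tail G (Inl e), edge_head G e}" "row_tail G (Inl e) \<noteq> edge_head G e"
    "other_end G e (row_tail G (Inl e)) = edge_head G e"
    "other_end G e (edge_head G e) = row_tail G (Inl e)"
proof -
  let ?a = "row_tail G (Inl e)"
  obtain x y where xy: "ends G e = {x, y}" "x \<noteq> y" using assms by (auto simp: card_2_iff)
  have "?a \<in> ends G e" unfolding row_tail_def sum.case by (rule someI[of _ x]) (simp add: xy)
  then obtain b where b: "ends G e = {?a, b}" "?a \<noteq> b" using xy by (cases "?a = x") auto
  then have eb: "edge_head G e = b" unfolding edge_head_def by (rule other_end_eq)
  have b': "ends G e = {b, ?a}" using b by auto
  show "ends G e = {?a, edge_head G e}" "?a \<noteq> edge_head G e" "other_end G e ?a = edge_head G e"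
    "other_end G e (edge_head G e) = ?a"
    using b eb other_end_eq[OF b] other_end_eq[OF b'] by simp_all
qed

definition row_vec :: "('v::finite, 'e, 'l) looped_graph \<Rightarrow> 'e + 'l \<Rightarrow> real^2 \<Rightarrow> real^2^'v" where
  "row_vec G = incidence_vector (row_tail G) (row_head G)"

lemma linear_row_vec: "linear (row_vec G r)"
  by (simp add: row_vec_def linear_incidence_vector)

lemma inner_row_vec:
  "inner (row_vec G (Inl e) d) h = inner d (vec_nth h (row_tail G (Inl e)) - vec_nth h (edge_head G e))"
  "inner (row_vec G (Inr l) d) h = inner d (vec_nth h (base G l))"
  by (simp_all add: row_vec_def inner_incidence_vector)

text \<open>Reversing the arbitrary orientation of an edge changes the sign of this direction and of
  the incidence vector alike, so the resulting row does not depend on the choice of the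
  tail.\<close>

definition row_dir ::
    "('v::finite, 'e, 'l) looped_graph \<Rightarrow> real^2^'v \<Rightarrow> ('l \<Rightarrow> real^2) \<Rightarrow> 'e + 'l \<Rightarrow> real^2" where
  "row_dir G p nrm r = (case r of
     Inl e \<Rightarrow> vec_nth p (row_tail G r) - vec_nth p (edge_head G e) | Inr l \<Rightarrow> nrm l)"

lemma row_dir_simps [simp]:
  "row_dir G p nrm (Inl e) = vec_nth p (row_tail G (Inl e)) - vec_nth p (edge_head G e)"
  "row_dir G p nrm (Inr l) = nrm l"
  by (simp_all add: row_dir_def)

lemma rigidity_row_eq_flatten:
  assumes "wf_looped_graph G" "r \<in> rigidity_rows G"
  shows "(\<chi> c. rigidity_entry G (\<lambda>v. vec_nth (vec_nth p v)) (\<lambda>l. vec_nth (nrm l)) r c) =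
    flatten (row_vec G r (row_dir G p nrm r))"
proof (cases r)
  case (Inl e)
  then have "card (ends G e) = 2" using assms by (auto simp: wf_looped_graph_def rigidity_rows_def)
  note e = edge_ends[OF this]
  show ?thesis
    unfolding Finite_Cartesian_Product.vec_eq_iff
    using e(2-4) by (auto simp: Inl flatten_def row_vec_def incidence_vector_def axis_def e(1))
next
  case (Inr l)
  then show ?thesis
    by (auto simp: Finite_Cartesian_Product.vec_eq_iff flatten_def row_vec_def incidence_vector_def axis_def)
qed

lemma rigidity_rank_eq_dim:
  assumes "wf_looped_graph G"
  shows "rigidity_rank G p nrm = dim ((\<lambda>r. row_vec G r (row_dir G p nrm r)) ` rigidity_rows G)"
proof -
  have "(\<lambda>r. (\<chi> c. rigidity_entry G (\<lambda>v. vec_nth (vec_nth p v)) (\<lambda>l. vec_nth (nrm l)) r c)) ` rigidity_rows G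
      = flatten ` ((\<lambda>r. row_vec G r (row_dir G p nrm r)) ` rigidity_rows G)"
    unfolding image_image using rigidity_row_eq_flatten[OF assms] by (intro image_cong refl)
  then show ?thesis
    unfolding rigidity_rank_def
    by (simp add: dim_image_eq[OF linear_flatten inj_on_subset[OF inj_flatten subset_UNIV]])
qed

lemma finite_rigidity_rows: "wf_looped_graph G \<Longrightarrow> finite (rigidity_rows G)"
  by (simp add: rigidity_rows_def wf_looped_graph_def)

lemma card_rigidity_rows:
  "wf_looped_graph G \<Longrightarrow> card (rigidity_rows G) = card (edges G) + card (loops G)"
  by (simp add: rigidity_rows_def wf_looped_graph_def card_Plus)

context
  fixes G :: "('v::finite, 'e, 'l) looped_graph"
  assumes wf: "wf_looped_graph G" and laman: "looped_laman G"
begin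

lemma finite_edges: "finite (edges G)" and finite_loops: "finite (loops G)"
  using wf by (simp_all add: wf_looped_graph_def)

lemma edge_ends_laman:
  assumes "e \<in> edges G"
  shows "ends G e = {row_tail G (Inl e), edge_head G e}" "row_tail G (Inl e) \<noteq> edge_head G e"
  using edge_ends[of G e] assms wf by (auto simp: wf_looped_graph_def)

lemma ends_subset:
  assumes "e \<in> edges G" "row_tail G (Inl e) \<in> C \<and> edge_head G e \<in> C"
  shows "ends G e \<subseteq> C"
  using assms(2) unfolding edge_ends_laman(1)[OF assms(1)] by simp

text \<open>The additive form avoids truncated subtraction; \<open>2 \<le> card C\<close> makes it
  agree with the definition.\<close>

lemma laman_edge_count:
  assumes "E' \<subseteq> edges G" "\<And>e. e \<in> E' \<Longrightarrow> row_tail G (Inl e) \<in> C \<and> edge_head G e \<in> C" "2 \<le> card C"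
  shows "card E' + 3 \<le> 2 * card C"
proof -
  have "ends G e \<subseteq> C" if "e \<in> E'" for e
    using assms(1) that by (intro ends_subset assms(2)) auto
  then have "is_subgraph C E' {} G" using assms(1) by (simp add: is_subgraph_def)
  then have "card E' \<le> 2 * card C - 3" using laman assms(3) by (auto simp: looped_laman_def)
  then show ?thesis using assms(3) by simp
qed

lemma card_ge_2_if_edge:
  assumes "e \<in> edges G" "row_tail G (Inl e) \<in> C" "edge_head G e \<in> C"
  shows "2 \<le> card (C :: 'v set)"
proof -
  have "card {row_tail G (Inl e), edge_head G e} \<le> card C" using assms by (intro card_mono) auto
  then show ?thesis using edge_ends_laman(2)[OF assms(1)] by simp
qed

text \<open>For a loop-free set with an edge, the Laman bound 2|C| - 3 is stronger than the 2|C| - 2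
  asked for; for an empty set, \<open>C \<noteq> {}\<close> provides the 2.\<close>

lemma laman_rows_independent:
  "\<exists>t. indep_family (\<lambda>r. row_vec G r (t r)) (rigidity_rows G)"
  unfolding row_vec_def
proof (rule ex_independent_directions[OF finite_rigidity_rows[OF wf]])
  fix I C assume I: "I \<subseteq> rigidity_rows G" "\<forall>i\<in>I. insert (row_tail G i) (set_option (row_head G i)) \<subseteq> C"
  let ?E = "{e. Inl e \<in> I}" and ?L = "{l. Inr l \<in> I}"
  have IEL: "I = ?E <+> ?L"
  proof (rule Set.set_eqI)
    fix r show "r \<in> I \<longleftrightarrow> r \<in> ?E <+> ?L" by (cases r) auto
  qed
  have sub: "?E \<subseteq> edges G" "?L \<subseteq> loops G" using I(1) by (auto simp: rigidity_rows_def)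
  have fin: "finite ?E" "finite ?L" using sub finite_edges finite_loops finite_subset by blast+
  have card: "card I = card ?E + card ?L" using fin by (subst IEL) (simp add: card_Plus)
  have E: "row_tail G (Inl e) \<in> C \<and> edge_head G e \<in> C" if "e \<in> ?E" for e using I(2) that by auto
  have "is_subgraph C ?E ?L G"
    unfolding is_subgraph_def
  proof (intro conjI ballI sub)
    fix e assume "e \<in> ?E" then show "ends G e \<subseteq> C" using sub(1) by (intro ends_subset E) auto
  next
    fix l assume "l \<in> ?L" then show "base G l \<in> C" using I(2) by force
  qed
  then show "card I \<le> 2 * card C" using laman unfolding looped_laman_def card by blast
  assume nl: "\<forall>i\<in>I. row_head G i \<noteq> None" and "C \<noteq> {}"
  have L: "?L = {}" using nl by force
  show "card I + 2 \<le> 2 * card C"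
  proof (cases "?E = {}")
    case True
    have "1 \<le> card C" using \<open>C \<noteq> {}\<close> by (simp add: Suc_le_eq card_gt_0_iff)
    moreover have "card I = 0" using True L card by simp
    ultimately show ?thesis by linarith
  next
    case False
    then obtain e where e: "e \<in> ?E" by blast
    then have "2 \<le> card C" using E[OF e] sub by (intro card_ge_2_if_edge[of e]) auto
    then show ?thesis using laman_edge_count[OF sub(1) E] L card by simp
  qed
qed

text \<open>The extra index \<open>None\<close> is a parallel copy of the edge \<open>e\<close>, the index \<open>Some f\<close> is the edge \<open>f\<close>.\<close>

lemma laman_doubled_edge_independent:
  assumes e: "e \<in> edges G"
  shows "\<exists>d t. indep_family (\<lambda>j. row_vec G (Inl (case j of None \<Rightarrow> e | Some f \<Rightarrow> f))
           (case j of None \<Rightarrow> d | Some f \<Rightarrow> t f)) (insert None (Some ` edges G))"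
proof -
  define \<pi> where "\<pi> j = (case j of None \<Rightarrow> e | Some f \<Rightarrow> f)" for j
  define u where "u j = row_tail G (Inl (\<pi> j))" for j
  define w where "w j = row_head G (Inl (\<pi> j))" for j
  let ?J = "insert None (Some ` edges G)"
  have \<pi>: "\<pi> j \<in> edges G" if "j \<in> ?J" for j using that e by (auto simp: \<pi>_def)
  \<comment> \<open>The copy adds at most one index, which the bound
    \<open>card ?E + 3 \<le> 2 * card C\<close> can absorb.\<close>
  have main: "card I + 2 \<le> 2 * card C \<or> I = {}"
    if I: "I \<subseteq> ?J" "\<forall>i\<in>I. insert (u i) (set_option (w i)) \<subseteq> C" for I C
  proof (cases "I = {}")
    case False
    then obtain j where j: "j \<in> I" by blast
    have C: "row_tail G (Inl (\<pi> i)) \<in> C \<and> edge_head G (\<pi> i) \<in> C" if "i \<in> I" for i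
      using I(2) that by (auto simp: u_def w_def)
    let ?E = "{f. Some f \<in> I}"
    have "2 \<le> card C" using C[OF j] \<pi> I(1) j by (intro card_ge_2_if_edge[of "\<pi> j"]) auto
    moreover have "?E \<subseteq> edges G" using I(1) by auto
    moreover have "row_tail G (Inl f) \<in> C \<and> edge_head G f \<in> C" if "f \<in> ?E" for f
      using C[of "Some f"] that by (simp add: \<pi>_def)
    ultimately have "card ?E + 3 \<le> 2 * card C" by (intro laman_edge_count)
    moreover have "card I \<le> card ?E + 1"
    proof -
      have "finite ?E" using \<open>?E \<subseteq> edges G\<close> finite_edges finite_subset by blast
      have "I \<subseteq> insert None (Some ` ?E)"
      proof
        fix x assume "x \<in> I" then show "x \<in> insert None (Some ` ?E)" by (cases x) auto
      qed
      then have "card I \<le> card (insert None (Some ` ?E))" using \<open>finite ?E\<close> by (intro card_mono) auto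
      also have "\<dots> = card ?E + 1" using \<open>finite ?E\<close> by (subst card_insert_disjoint) (auto simp: card_image)
      finally show ?thesis .
    qed
    ultimately show ?thesis by simp
  qed simp
  have "\<exists>t. indep_family (\<lambda>i. incidence_vector u w i (t i)) ?J"
  proof (rule ex_independent_directions)
    show "finite ?J" using finite_edges by simp
    fix I C assume I: "I \<subseteq> ?J" "\<forall>i\<in>I. insert (u i) (set_option (w i)) \<subseteq> C"
    show "card I \<le> 2 * card C" using main[OF I] by auto
    assume "C \<noteq> {}"
    then have "card C \<noteq> 0" by simp
    then show "card I + 2 \<le> 2 * card C" using main[OF I] by (auto simp del: card_0_eq)
  qed
  then obtain t where t: "indep_family (\<lambda>i. incidence_vector u w i (t i)) ?J" by blast
  define s where "s f = t (Some f)" for f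
  have "incidence_vector u w i (t i) = row_vec G (Inl (case i of None \<Rightarrow> e | Some f \<Rightarrow> f))
      (case i of None \<Rightarrow> t None | Some f \<Rightarrow> s f)" for i
    by (cases i) (simp_all add: row_vec_def incidence_vector_def u_def w_def \<pi>_def s_def)
  then show ?thesis using t by (intro exI[of _ "t None"] exI[of _ s]) simp
qed

end

section \<open>A realization of full rank\<close>

definition rot90 :: "real^2 \<Rightarrow> real^2" where
  "rot90 x = (\<chi> k. if k = 1 then - vec_nth x 2 else vec_nth x 1)"

lemma vec_nth_rot90 [simp]: "vec_nth (rot90 x) 1 = - vec_nth x 2" "vec_nth (rot90 x) 2 = vec_nth x 1"
  by (simp_all add: rot90_def)

lemma inner_real2: "inner x y = vec_nth x 1 * vec_nth y 1 + vec_nth x 2 * vec_nth y 2" for x y :: "real^2"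
  by (simp add: inner_vec_def sum_2)

lemma vec_eq_real2: "x = y \<longleftrightarrow> vec_nth x 1 = vec_nth y 1 \<and> vec_nth x 2 = vec_nth y 2" for x y :: "real^2"
  by (simp add: Finite_Cartesian_Product.vec_eq_iff forall_2)

lemma rot90_diff: "rot90 (x - y) = rot90 x - rot90 y"
  by (simp add: vec_eq_real2)

lemma inner_rot90: "inner x (rot90 x) = 0"
  by (simp add: inner_real2)

lemma orthogonal_imp_multiple_rot90:
  assumes "inner x d = 0" "d \<noteq> 0"
  shows "\<exists>c. x = c *\<^sub>R rot90 d"
proof -
  define q where "q = vec_nth d 1 ^ 2 + vec_nth d 2 ^ 2"
  have "q \<noteq> 0" using assms(2) by (auto simp: q_def vec_eq_real2)
  have o: "vec_nth x 1 * vec_nth d 1 + vec_nth x 2 * vec_nth d 2 = 0"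
    using assms(1) by (simp add: inner_real2)
  \<comment> \<open>The coefficient of the projection onto \<open>rot90 d\<close>: the inner product
    of \<open>x\<close> with \<open>rot90 d\<close>, divided by the squared norm \<open>q\<close> of
    \<open>d\<close>.\<close>
  define c where "c = (vec_nth x 2 * vec_nth d 1 - vec_nth x 1 * vec_nth d 2) / q"
  have "vec_nth x 1 * q + c * q * vec_nth d 2 = vec_nth d 1 * (vec_nth x 1 * vec_nth d 1 + vec_nth x 2 * vec_nth d 2)"
    using \<open>q \<noteq> 0\<close> by (simp add: c_def) (simp add: q_def power2_eq_square algebra_simps)
  then have "(vec_nth x 1 + c * vec_nth d 2) * q = 0" unfolding o by (simp add: algebra_simps)
  moreover have "vec_nth x 2 * q - c * q * vec_nth d 1 = vec_nth d 2 * (vec_nth x 1 * vec_nth d 1 + vec_nth x 2 * vec_nth d 2)"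
    using \<open>q \<noteq> 0\<close> by (simp add: c_def) (simp add: q_def power2_eq_square algebra_simps)
  then have "(vec_nth x 2 - c * vec_nth d 1) * q = 0" unfolding o by (simp add: algebra_simps)
  ultimately have "x = c *\<^sub>R rot90 d"
    using \<open>q \<noteq> 0\<close> by (simp add: vec_eq_real2 add_eq_0_iff2)
  then show ?thesis by blast
qed

text \<open>\<open>a\<close> and \<open>a + b\<close> are the values at the parameters 0 and 1, so
  the line is not constantly zero and has at most one zero.\<close>

lemma finite_affine_zeros:
  fixes a b :: "'a::real_inner"
  assumes "a \<noteq> 0 \<or> a + b \<noteq> 0"
  shows "finite {t. a + t *\<^sub>R b = 0}"
proof (cases "b = 0")
  case True
  then show ?thesis using assms by simp
next
  case False
  have "{t. a + t *\<^sub>R b = 0} \<subseteq> {- inner a b / inner b b}"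
  proof safe
    fix t assume "a + t *\<^sub>R b = 0"
    then have "inner (a + t *\<^sub>R b) b = 0" by simp
    then show "t = - inner a b / inner b b" using False by (simp add: inner_add_left field_simps)
  qed
  then show ?thesis by (rule finite_subset) simp
qed

lemma orthogonal_functional_exists:
  fixes x :: "'a::euclidean_space"
  assumes "x \<notin> span S"
  shows "\<exists>h. (\<forall>s\<in>S. inner s h = 0) \<and> inner x h \<noteq> 0"
proof -
  have "\<exists>y z. y \<in> span S \<and> (\<forall>w\<in>span S. Linear_Algebra.orthogonal z w) \<and> x = y + z"
    by (rule orthogonal_subspace_decomp_exists[of S x]) blast
  then obtain y z where yz: "y \<in> span S" "\<And>w. w \<in> span S \<Longrightarrow> Linear_Algebra.orthogonal z w" "x = y + z"
    by blast
  have "z \<noteq> 0" using yz assms by auto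
  moreover have "inner x z = inner z z"
    using yz(2)[OF yz(1)] by (simp add: yz(3) inner_add_left inner_add_right Linear_Algebra.orthogonal_def inner_commute)
  moreover have "inner s z = 0" if "s \<in> S" for s
    using yz(2)[OF span_base[OF that]] by (simp add: Linear_Algebra.orthogonal_def inner_commute)
  ultimately show ?thesis by (intro exI[of _ z]) simp
qed

context
  fixes G :: "('v::finite, 'e, 'l) looped_graph"
  assumes wf: "wf_looped_graph G" and laman: "looped_laman G"
begin

text \<open>One assignment must serve the whole network and all doubled edges simultaneously. Each
  condition can be met separately and persists cofinitely along lines. The second conjunct leaves
  room for a solution of the edge network that does not collapse \<open>e\<close>.\<close>

lemma laman_generic_directions:
  "\<exists>t. indep_family (\<lambda>r. row_vec G r (t r)) (rigidity_rows G) \<and>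
       (\<forall>e\<in>edges G. \<exists>d. row_vec G (Inl e) d \<notin> span ((\<lambda>f. row_vec G (Inl f) (t (Inl f))) ` edges G))"
proof -
  define \<pi> :: "'e \<Rightarrow> 'e option \<Rightarrow> 'e + 'l" where "\<pi> e j = Inl (case j of None \<Rightarrow> e | Some f \<Rightarrow> f)" for e j
  have "\<exists>d. \<forall>e\<in>edges G. \<exists>t. indep_family (\<lambda>j. row_vec G (\<pi> e j)
           (case j of None \<Rightarrow> d e | Some f \<Rightarrow> t f)) (insert None (Some ` edges G))"
    using laman_doubled_edge_independent[OF wf laman] unfolding \<pi>_def by (intro bchoice ballI)
  then obtain d where d: "\<forall>e\<in>edges G. \<exists>t. indep_family (\<lambda>j. row_vec G (\<pi> e j)
           (case j of None \<Rightarrow> d e | Some f \<Rightarrow> t f)) (insert None (Some ` edges G))"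
    by (rule exE)
  let ?D = "\<lambda>e. insert None (Some ` edges G)"
  define V :: "'e \<Rightarrow> ('e + 'l \<Rightarrow> real^2) \<Rightarrow> 'e option \<Rightarrow> real^2^'v" where
    "V e t j = row_vec G (\<pi> e j) (case j of None \<Rightarrow> d e | Some f \<Rightarrow> t (Inl f))" for e t j
  \<comment> \<open>\<open>None\<close> stands for the network of all rows, \<open>Some e\<close>
    for the edge network with \<open>e\<close> doubled.\<close>
  define P where "P k t \<longleftrightarrow> (case k of
      None \<Rightarrow> indep_family (\<lambda>r. row_vec G r (t r)) (rigidity_rows G)
    | Some e \<Rightarrow> indep_family (V e t) (?D e))" for k t
  \<comment> \<open>The line through \<open>t\<close> and \<open>u\<close>; it meets them at the
    parameters 0 and 1.\<close>
  define L :: "('e + 'l \<Rightarrow> real^2) \<Rightarrow> ('e + 'l \<Rightarrow> real^2) \<Rightarrow> real \<Rightarrow> 'e + 'l \<Rightarrow> real^2" where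
    "L t u \<tau> = (\<lambda>r. t r + \<tau> *\<^sub>R (u r - t r))" for t u \<tau>
  have L01: "L t u 0 = t" "L t u 1 = u" for t u by (simp_all add: L_def)
  have finE: "finite (edges G)" using wf by (simp add: wf_looped_graph_def)
  have "\<exists>t\<in>UNIV. \<forall>k\<in>insert None (Some ` edges G). P k t"
  proof (rule cofinite_on_lines_common_point[where L = L])
    show "finite (insert None (Some ` edges G))" using finE by simp
  next
    fix k assume k: "k \<in> insert None (Some ` edges G)"
    show "\<exists>t\<in>UNIV. P k t"
    proof (cases k)
      case None
      then show ?thesis using laman_rows_independent[OF wf laman] by (simp add: P_def)
    next
      case (Some e)
      then obtain t where t: "indep_family (\<lambda>j. row_vec G (\<pi> e j)
           (case j of None \<Rightarrow> d e | Some f \<Rightarrow> t f)) (insert None (Some ` edges G))"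
        using d k by auto
      \<comment> \<open>\<open>t\<close> is given on edges only. Its extension is arbitrary at
        loops, where \<open>V\<close> never looks.\<close>
      have "V e (\<lambda>r. t (projl r)) = (\<lambda>j. row_vec G (\<pi> e j) (case j of None \<Rightarrow> d e | Some f \<Rightarrow> t f))"
        by (simp add: V_def fun_eq_iff split: option.split)
      then have "P k (\<lambda>r. t (projl r))" using t Some by (simp add: P_def)
      then show ?thesis by blast
    qed
  next
    fix k t u assume k: "k \<in> insert None (Some ` edges G)" and tu: "P k t \<or> P k u"
    show "finite {\<tau>. \<not> P k (L t u \<tau>)}"
    proof -
      from tu L01 have "P k (L t u 0) \<or> P k (L t u 1)" by simp
      then obtain \<tau>0 where "P k (L t u \<tau>0)" by blast
      show ?thesis
      proof (cases k)
        case None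
        then show ?thesis
          using \<open>P k (L t u \<tau>0)\<close> finite_rigidity_rows[OF wf]
          unfolding P_def L_def row_vec_def option.case
          by (simp add: incidence_line_independence_cofinite)
      next
        case (Some e)
        \<comment> \<open>The direction \<open>d e\<close> of the copy is fixed once and for all,
          hence its increment 0.\<close>
        have V: "V e (L t u \<tau>) = (\<lambda>j. incidence_vector (\<lambda>j. row_tail G (\<pi> e j)) (\<lambda>j. row_head G (\<pi> e j)) j
          ((case j of None \<Rightarrow> d e | Some f \<Rightarrow> t (Inl f)) +
            \<tau> *\<^sub>R (case j of None \<Rightarrow> 0 | Some f \<Rightarrow> u (Inl f) - t (Inl f))))" for \<tau>
          by (simp add: V_def L_def fun_eq_iff row_vec_def incidence_vector_def split: option.split)
        show ?thesis
          using \<open>P k (L t u \<tau>0)\<close> finE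
          unfolding P_def Some option.case V
          by (intro incidence_line_independence_cofinite) simp_all
      qed
    qed
  qed simp_all
  then obtain t where t: "\<And>k. k \<in> insert None (Some ` edges G) \<Longrightarrow> P k t" by blast
  have "row_vec G (Inl e) (d e) \<notin> span ((\<lambda>f. row_vec G (Inl f) (t (Inl f))) ` edges G)"
    if "e \<in> edges G" for e
  proof -
    have i: "inj_on (V e t) (?D e)" "independent (V e t ` ?D e)"
      using t[of "Some e"] that by (simp_all add: P_def indep_family_def)
    have im: "V e t ` Some ` edges G = (\<lambda>f. row_vec G (Inl f) (t (Inl f))) ` edges G"
      by (simp add: image_image V_def \<pi>_def)
    have "V e t None \<notin> V e t ` Some ` edges G"
      using inj_on_image_mem_iff[OF i(1), of None "Some ` edges G"] by auto
    then have "V e t None \<notin> span (V e t ` Some ` edges G)"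
      using i(2) by (simp add: independent_insert)
    then show ?thesis unfolding im by (simp add: V_def \<pi>_def)
  qed
  moreover have "indep_family (\<lambda>r. row_vec G r (t r)) (rigidity_rows G)"
    using t[of None] by (simp add: P_def)
  ultimately show ?thesis by blast
qed

text \<open>In a direction network with independent edge directions some solution collapses no edge; turning
  that solution by a right angle makes every edge parallel to its prescribed direction, so the rows
  of the rigidity matrix are nonzero multiples of those of the direction network.\<close>

lemma laman_ex_full_rank:
  "\<exists>p nrm. rigidity_rank G p nrm = 2 * CARD('v)"
proof -
  obtain t where t: "indep_family (\<lambda>r. row_vec G r (t r)) (rigidity_rows G)"
    and ext: "\<And>e. e \<in> edges G \<Longrightarrow>
      \<exists>d. row_vec G (Inl e) d \<notin> span ((\<lambda>f. row_vec G (Inl f) (t (Inl f))) ` edges G)"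
    using laman_generic_directions by blast
  define \<delta> where "\<delta> e h = vec_nth h (row_tail G (Inl e)) - vec_nth h (edge_head G e)"
    for e and h :: "real^2^'v"
  \<comment> \<open>Solutions of the edge part only. The loop rows do not involve the point, so
    their directions can be used as normals directly.\<close>
  define K where "K = {h. \<forall>e\<in>edges G. inner (t (Inl e)) (\<delta> e h) = 0}"
  have finE: "finite (edges G)" using wf by (simp add: wf_looped_graph_def)
  have \<delta>: "\<delta> e (h + \<tau> *\<^sub>R (h' - h)) = \<delta> e h + \<tau> *\<^sub>R (\<delta> e h' - \<delta> e h)" for e h h' \<tau>
    by (simp add: \<delta>_def algebra_simps)
  have "\<exists>h\<in>K. \<forall>e\<in>edges G. \<delta> e h \<noteq> 0"
  proof (rule cofinite_on_lines_common_point[where L = "\<lambda>h h' \<tau>. h + \<tau> *\<^sub>R (h' - h)"])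
    show "finite (edges G)" by (rule finE)
    show "K \<noteq> {}" by (auto simp: K_def \<delta>_def intro!: exI[of _ 0])
    fix e assume e: "e \<in> edges G"
    show "\<exists>h\<in>K. \<delta> e h \<noteq> 0"
    proof -
      obtain d where "row_vec G (Inl e) d \<notin> span ((\<lambda>f. row_vec G (Inl f) (t (Inl f))) ` edges G)"
        using ext[OF e] by blast
      from orthogonal_functional_exists[OF this] obtain h where
        h: "\<forall>f\<in>edges G. inner (row_vec G (Inl f) (t (Inl f))) h = 0" "inner (row_vec G (Inl e) d) h \<noteq> 0"
        by auto
      have "h \<in> K" using h(1) by (simp add: K_def \<delta>_def inner_row_vec)
      moreover have "\<delta> e h \<noteq> 0" using h(2) by (auto simp: \<delta>_def inner_row_vec)
      ultimately show ?thesis by blast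
    qed
    fix h h' assume "\<delta> e h \<noteq> 0 \<or> \<delta> e h' \<noteq> 0"
    then show "finite {\<tau>. \<not> \<delta> e (h + \<tau> *\<^sub>R (h' - h)) \<noteq> 0}"
      unfolding \<delta> by (simp add: finite_affine_zeros)
  next
    fix h h' \<tau> assume "h \<in> K" "h' \<in> K"
    then show "h + \<tau> *\<^sub>R (h' - h) \<in> K"
      by (simp add: K_def \<delta> inner_add_right inner_diff_right)
  qed
  then obtain h where h: "h \<in> K" "\<And>e. e \<in> edges G \<Longrightarrow> \<delta> e h \<noteq> 0" by blast
  define p :: "real^2^'v" where "p = (\<chi> v. rot90 (vec_nth h v))"
  define nrm where "nrm l = t (Inr l)" for l
  \<comment> \<open>In the plane, \<open>t (Inl e)\<close> and the turned difference are both
    orthogonal to the nonzero \<open>\<delta> e h\<close>, hence parallel. That \<open>c\<close> is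
    nonzero on every row follows later from independence.\<close>
  have "\<exists>c. t r = c *\<^sub>R row_dir G p nrm r" if r: "r \<in> rigidity_rows G" for r
  proof (cases r)
    case (Inl e)
    then have e: "e \<in> edges G" using r by (auto simp: rigidity_rows_def)
    then have "\<exists>c. t (Inl e) = c *\<^sub>R rot90 (\<delta> e h)"
      using h by (intro orthogonal_imp_multiple_rot90) (auto simp: K_def)
    then show ?thesis by (simp add: Inl p_def \<delta>_def rot90_diff)
  next
    case (Inr l)
    then show ?thesis by (intro exI[of _ 1]) (simp add: nrm_def)
  qed
  then have "\<exists>c. \<forall>r\<in>rigidity_rows G. t r = c r *\<^sub>R row_dir G p nrm r" by (intro bchoice ballI)
  then obtain c where c: "\<And>r. r \<in> rigidity_rows G \<Longrightarrow> t r = c r *\<^sub>R row_dir G p nrm r" by blast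
  have eq: "row_vec G r (t r) = c r *\<^sub>R row_vec G r (row_dir G p nrm r)" if "r \<in> rigidity_rows G" for r
    using c[OF that] by (simp add: linear_scale[OF linear_row_vec])
  have "indep_family (\<lambda>r. c r *\<^sub>R row_vec G r (row_dir G p nrm r)) (rigidity_rows G)"
    using t inj_on_cong[OF eq, of "rigidity_rows G"] image_cong[OF refl eq, of "rigidity_rows G"]
    by (simp add: indep_family_def)
  then have "indep_family (\<lambda>r. row_vec G r (row_dir G p nrm r)) (rigidity_rows G)"
    by (rule indep_family_descale[OF finite_rigidity_rows[OF wf]])
  then have "rigidity_rank G p nrm = card (rigidity_rows G)"
    unfolding rigidity_rank_eq_dim[OF wf] by (rule indep_family_card_eq_dim)
  also have "\<dots> = 2 * CARD('v)" using laman by (simp add: card_rigidity_rows[OF wf] looped_laman_def)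
  finally show ?thesis by blast
qed

end

section \<open>Generic rank\<close>

definition monom_eval :: "('x \<Rightarrow> real) \<Rightarrow> ('x \<Rightarrow>\<^sub>0 nat) \<Rightarrow> real" where
  "monom_eval a m = (\<Prod>x\<in>Poly_Mapping.keys m. a x ^ Poly_Mapping.lookup m x)"

definition poly_eval :: "('x \<Rightarrow> real) \<Rightarrow> (('x \<Rightarrow>\<^sub>0 nat) \<Rightarrow>\<^sub>0 real) \<Rightarrow> real" where
  "poly_eval a P = (\<Sum>m\<in>Poly_Mapping.keys P. Poly_Mapping.lookup P m * monom_eval a m)"

lemma monom_eval_superset:
  "finite S \<Longrightarrow> Poly_Mapping.keys m \<subseteq> S \<Longrightarrow> monom_eval a m = (\<Prod>x\<in>S. a x ^ Poly_Mapping.lookup m x)"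
  unfolding monom_eval_def by (rule prod.mono_neutral_left) (auto simp: in_keys_iff)

lemma monom_eval_add: "monom_eval a (m + n) = monom_eval a m * monom_eval a n"
proof -
  let ?S = "Poly_Mapping.keys m \<union> Poly_Mapping.keys n"
  have "Poly_Mapping.keys (m + n) \<subseteq> ?S" by (rule Poly_Mapping.keys_add)
  then show ?thesis
    by (simp add: monom_eval_superset[of ?S] lookup_add power_add prod.distrib)
qed

lemma poly_eval_superset:
  "finite S \<Longrightarrow> Poly_Mapping.keys P \<subseteq> S \<Longrightarrow> poly_eval a P = (\<Sum>m\<in>S. Poly_Mapping.lookup P m * monom_eval a m)"
  unfolding poly_eval_def by (rule sum.mono_neutral_left) (auto simp: in_keys_iff)

lemma poly_eval_add: "poly_eval a (P + Q) = poly_eval a P + poly_eval a Q"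
proof -
  let ?S = "Poly_Mapping.keys P \<union> Poly_Mapping.keys Q"
  have "Poly_Mapping.keys (P + Q) \<subseteq> ?S" by (rule Poly_Mapping.keys_add)
  then show ?thesis
    by (simp add: poly_eval_superset[of ?S] lookup_add algebra_simps sum.distrib)
qed

lemma poly_eval_zero: "poly_eval a 0 = 0"
  by (simp add: poly_eval_def)

lemma poly_eval_sum: "poly_eval a (\<Sum>i\<in>I. f i) = (\<Sum>i\<in>I. poly_eval a (f i))"
  by (induction I rule: infinite_finite_induct) (simp_all add: poly_eval_add poly_eval_zero)

lemma poly_eval_single: "poly_eval a (Poly_Mapping.single m c) = c * monom_eval a m"
  by (simp add: poly_eval_superset[of "{m}"])

lemma poly_mapping_eq_sum_single:
  "P = (\<Sum>m\<in>Poly_Mapping.keys P. Poly_Mapping.single m (Poly_Mapping.lookup P m))"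
  by (rule poly_mapping_eqI) (simp add: lookup_sum lookup_single when_def in_keys_iff)

lemma poly_eval_mult: "poly_eval a (P * Q) = poly_eval a P * poly_eval a Q"
proof -
  let ?p = "Poly_Mapping.lookup P" and ?q = "Poly_Mapping.lookup Q"
  have "P * Q = (\<Sum>m\<in>Poly_Mapping.keys P. \<Sum>n\<in>Poly_Mapping.keys Q. Poly_Mapping.single (m + n) (?p m * ?q n))"
    by (subst poly_mapping_eq_sum_single[of P], subst poly_mapping_eq_sum_single[of Q])
      (simp add: sum_product mult_single)
  then have "poly_eval a (P * Q) =
      (\<Sum>m\<in>Poly_Mapping.keys P. \<Sum>n\<in>Poly_Mapping.keys Q. (?p m * monom_eval a m) * (?q n * monom_eval a n))"
    by (simp add: poly_eval_sum poly_eval_single monom_eval_add mult_ac)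
  then show ?thesis by (simp add: poly_eval_def sum_product)
qed

lemma poly_eval_one: "poly_eval a 1 = 1"
proof -
  have "poly_eval a (Poly_Mapping.single 0 1) = 1"
    unfolding poly_eval_single by (simp add: monom_eval_def)
  then show ?thesis by simp
qed

text \<open>Being a ring homomorphism, evaluation commutes with determinants, so formal minors
  evaluate to real minors.\<close>

interpretation poly_eval: comm_ring_hom "poly_eval a" for a
  by unfold_locales (simp_all add: poly_eval_add poly_eval_mult poly_eval_zero poly_eval_one)

lemma poly_eval_Var: "poly_eval a (Var x) = a x"
  unfolding Var_def poly_eval_single by (simp add: monom_eval_def)

lemma poly_eval_rigidity_entry:
  "poly_eval a (rigidity_entry G (\<lambda>v k. Var (Pos v k)) (\<lambda>l k. Var (Nrm l k)) r c) =
     rigidity_entry G (\<lambda>v k. a (Pos v k)) (\<lambda>l k. a (Nrm l k)) r c"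
  by (cases r; cases c) (simp_all add: poly_eval_Var poly_eval.hom_minus)

text \<open>A basis of the row space is completed by coordinate axes to a basis of the whole space,
  and the columns of the added axes are discarded. If the remaining minor were singular, a
  nontrivial combination of the chosen rows would lie in the span of the added axes.\<close>

lemma ex_nonzero_minor:
  fixes R :: "'r \<Rightarrow> real^'c"
  shows "\<exists>\<rho> \<gamma>. inj_on \<rho> {..<dim (R ` X)} \<and> \<rho> ` {..<dim (R ` X)} \<subseteq> X \<and> inj_on \<gamma> {..<dim (R ` X)} \<and>
    Determinant.det (Matrix.mat (dim (R ` X)) (dim (R ` X)) (\<lambda>(i, j). vec_nth (R (\<rho> i)) (\<gamma> j))) \<noteq> 0"
proof -
  define d where "d = dim (R ` X)"
  obtain B where B: "B \<subseteq> R ` X" "independent B" "card B = d"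
    unfolding d_def using basis_exists[of "R ` X"] by metis
  have finB: "finite B" using B(2) by (rule independent_imp_finite)
  define ax :: "'c \<Rightarrow> real^'c" where "ax c = axis c 1" for c
  obtain B' where B': "B \<subseteq> B'" "B' \<subseteq> B \<union> range ax" "independent B'" "B \<union> range ax \<subseteq> span B'"
    by (rule maximal_independent_subset_extend[OF Un_upper1 B(2), of "range ax"])
  have finB': "finite B'" using B'(3) by (rule independent_imp_finite)
  have axes_sum: "x = (\<Sum>c\<in>UNIV. vec_nth x c *\<^sub>R ax c)" for x :: "real^'c"
    using basis_expansion[of x] by (simp add: scalar_mult_eq_scaleR ax_def)
  have "x \<in> span B'" for x
  proof -
    have "(\<Sum>c\<in>UNIV. vec_nth x c *\<^sub>R ax c) \<in> span B'"
      using B'(4) by (intro span_sum span_mul) auto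
    then show ?thesis using axes_sum[of x] by simp
  qed
  then have "dim B' = CARD('c)" using dim_eq_full[of B'] by auto
  then have cardB': "card B' = CARD('c)" using dim_eq_card_independent[OF B'(3)] by simp
  \<comment> \<open>The discarded columns; exactly \<open>d\<close> columns remain.\<close>
  define C where "C = {c. ax c \<in> B' - B}"
  have inj_axis: "inj_on ax S" for S
    by (auto simp: inj_on_def ax_def axis_eq_axis)
  have imC: "ax ` C = B' - B" using B'(2) by (auto simp: C_def)
  have "card C = card B' - card B"
    using card_image[OF inj_axis, of C] imC card_Diff_subset[OF finB B'(1)] by simp
  moreover have "card B \<le> card B'" using B'(1) finB' by (rule card_mono[rotated])
  moreover have "card (- C) = CARD('c) - card C" by (simp add: Compl_eq_Diff_UNIV card_Diff_subset)
  ultimately have "card (- C) = d" using B(3) cardB' by simp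
  then obtain \<gamma> where \<gamma>: "bij_betw \<gamma> {..<d} (- C)"
    using ex_bij_betw_nat_finite[of "- C"] by (auto simp: lessThan_atLeast0)
  obtain \<beta> where \<beta>: "bij_betw \<beta> {..<d} B"
    using ex_bij_betw_nat_finite[OF finB] B(3) by (auto simp: lessThan_atLeast0)
  define \<rho> where "\<rho> i = inv_into X R (\<beta> i)" for i
  have \<beta>B: "\<beta> i \<in> B" if "i < d" for i using bij_betwE[OF \<beta>] that by simp
  have R\<rho>: "R (\<rho> i) = \<beta> i" "\<rho> i \<in> X" if "i < d" for i
    using \<beta>B[OF that] B(1) by (auto simp: \<rho>_def f_inv_into_f inv_into_into)
  have "inj_on \<rho> {..<d}"
  proof (rule inj_onI)
    fix i j assume "i \<in> {..<d}" "j \<in> {..<d}" "\<rho> i = \<rho> j"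
    then show "i = j" using R\<rho>(1)[of i] R\<rho>(1)[of j] bij_betw_imp_inj_on[OF \<beta>] by (auto dest: inj_onD)
  qed
  moreover have "\<rho> ` {..<d} \<subseteq> X" using R\<rho>(2) by auto
  moreover have "inj_on \<gamma> {..<d}" using \<gamma> by (rule bij_betw_imp_inj_on)
  moreover have "Determinant.det (Matrix.mat d d (\<lambda>(i, j). vec_nth (R (\<rho> i)) (\<gamma> j))) \<noteq> 0"
  proof
    define A where "A = Matrix.mat d d (\<lambda>(i, j). vec_nth (R (\<rho> i)) (\<gamma> j))"
    assume "Determinant.det (Matrix.mat d d (\<lambda>(i, j). vec_nth (R (\<rho> i)) (\<gamma> j))) = 0"
    then have "Determinant.det A = 0" by (simp add: A_def)
    moreover have A: "A \<in> carrier_mat d d" by (simp add: A_def)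
    \<comment> \<open>The transpose is used because the sought relation is between rows, whereas the
      kernel vector belongs to columns.\<close>
    ultimately have "Determinant.det (transpose_mat A) = 0" by (simp add: Determinant.det_transpose[OF A])
    moreover have "transpose_mat A \<in> carrier_mat d d" using A by simp
    ultimately obtain v where v: "v \<in> carrier_vec d" "v \<noteq> 0\<^sub>v d" "transpose_mat A *\<^sub>v v = 0\<^sub>v d"
      using det_0_iff_vec_prod_zero_field[of "transpose_mat A" d] by blast
    define x where "x = (\<Sum>i<d. vec_index v i *\<^sub>R \<beta> i)"
    have x0: "vec_nth x c = 0" if "c \<notin> C" for c
    proof -
      have "c \<in> \<gamma> ` {..<d}" using \<gamma> that by (simp add: bij_betw_def)
      then obtain j where j: "j < d" "c = \<gamma> j" by auto
      have "vec_index (transpose_mat A *\<^sub>v v) j = (\<Sum>i<d. vec_nth (R (\<rho> i)) (\<gamma> j) * vec_index v i)"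
        using j v(1) by (simp add: A_def scalar_prod_def lessThan_atLeast0)
      then show ?thesis using v(3) j R\<rho>(1) by (simp add: x_def mult.commute)
    qed
    define f :: "nat + 'c \<Rightarrow> real^'c" where "f s = (case s of Inl i \<Rightarrow> \<beta> i | Inr c \<Rightarrow> ax c)" for s
    let ?S = "{..<d} <+> C"
    have "f ` ?S = \<beta> ` {..<d} \<union> ax ` C" by (simp add: Plus_def image_Un image_image f_def)
    also have "\<dots> = B'" using bij_betw_imp_surj_on[OF \<beta>] imC B'(1) by auto
    finally have imf: "f ` ?S = B'" .
    have "card ?S = card B'"
      using \<open>card C = card B' - card B\<close> \<open>card B \<le> card B'\<close> B(3) by (simp add: card_Plus)
    then have "indep_family f ?S"
      using imf B'(3) by (simp add: indep_family_def eq_card_imp_inj_on)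
    \<comment> \<open>\<open>x\<close> lives on the coordinates in \<open>C\<close>, so subtracting
      its expansion in the added axes gives a relation among the members of
      \<open>B'\<close>.\<close>
    moreover have "(\<Sum>s\<in>?S. (case s of Inl i \<Rightarrow> vec_index v i | Inr c \<Rightarrow> - vec_nth x c) *\<^sub>R f s) = 0"
    proof -
      have "(\<Sum>s\<in>?S. (case s of Inl i \<Rightarrow> vec_index v i | Inr c \<Rightarrow> - vec_nth x c) *\<^sub>R f s) =
          x - (\<Sum>c\<in>C. vec_nth x c *\<^sub>R ax c)"
        by (simp add: sum.Plus f_def x_def sum_negf)
      also have "(\<Sum>c\<in>C. vec_nth x c *\<^sub>R ax c) = (\<Sum>c\<in>UNIV. vec_nth x c *\<^sub>R ax c)"
        using x0 by (intro sum.mono_neutral_left) auto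
      finally show ?thesis using axes_sum[of x] by simp
    qed
    ultimately have "\<forall>s\<in>?S. (case s of Inl i \<Rightarrow> vec_index v i | Inr c \<Rightarrow> - vec_nth x c) = 0"
      using indep_family_iff[of ?S f] by simp
    then have "vec_index v i = 0" if "i < d" for i using that by force
    then have "v = 0\<^sub>v d" using v(1) by (intro eq_vecI) auto
    then show False using v(2) by contradiction
  qed
  ultimately show ?thesis unfolding d_def[symmetric] by blast
qed

text \<open>A minor that is nonzero at the actual values is the evaluation of a formal minor, which
  therefore is not the zero polynomial.\<close>

lemma rigidity_rank_le_generic:
  fixes G :: "('v::finite, 'e, 'l) looped_graph"
  shows "rigidity_rank G p nrm \<le> generic_rigidity_rank G"
proof -
  define M where "M = {r. \<exists>\<rho> \<gamma>. inj_on \<rho> {..<r} \<and> \<rho> ` {..<r} \<subseteq> rigidity_rows G \<and> inj_on \<gamma> {..<r} \<and>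
            Determinant.det (Matrix.mat r r (\<lambda>(i, j).
              rigidity_entry G (\<lambda>v k. Var (Pos v k)) (\<lambda>l k. Var (Nrm l k)) (\<rho> i) (\<gamma> j)))
            \<noteq> (0 :: ('v, 'l) coord_poly)}"
  \<comment> \<open>A minor has no more columns than the matrix, so \<open>Max\<close> is taken over
    a finite set.\<close>
  have "r \<le> CARD('v \<times> 2)" if r: "r \<in> M" for r
  proof -
    obtain \<gamma> :: "nat \<Rightarrow> 'v \<times> 2" where "inj_on \<gamma> {..<r}" using r unfolding M_def by blast
    then have "card {..<r} \<le> CARD('v \<times> 2)" by (intro card_inj_on_le) auto
    then show ?thesis by simp
  qed
  then have fin: "finite M" by (meson finite_nat_set_iff_bounded_le)
  define R :: "'e + 'l \<Rightarrow> real^('v \<times> 2)" where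
    "R r = (\<chi> c. rigidity_entry G (\<lambda>v. vec_nth (vec_nth p v)) (\<lambda>l. vec_nth (nrm l)) r c)" for r
  define a where "a x = (case x of Pos v k \<Rightarrow> vec_nth (vec_nth p v) k | Nrm l k \<Rightarrow> vec_nth (nrm l) k)" for x
  define d where "d = dim (R ` rigidity_rows G)"
  obtain \<rho> \<gamma> where \<rho>\<gamma>: "inj_on \<rho> {..<d}" "\<rho> ` {..<d} \<subseteq> rigidity_rows G" "inj_on \<gamma> {..<d}"
    "Determinant.det (Matrix.mat d d (\<lambda>(i, j). vec_nth (R (\<rho> i)) (\<gamma> j))) \<noteq> 0"
    unfolding d_def using ex_nonzero_minor[of R "rigidity_rows G"] by blast
  define F where "F = Matrix.mat d d (\<lambda>(i, j).
              rigidity_entry G (\<lambda>v k. Var (Pos v k)) (\<lambda>l k. Var (Nrm l k)) (\<rho> i) (\<gamma> j) :: ('v, 'l) coord_poly)"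
  have "Matrix.mat d d (\<lambda>(i, j). vec_nth (R (\<rho> i)) (\<gamma> j)) = map_mat (poly_eval a) F"
    by (rule eq_matI) (simp_all add: F_def R_def poly_eval_rigidity_entry a_def)
  then have "Determinant.det F \<noteq> 0" using \<rho>\<gamma>(4) by auto
  then have "d \<in> M" unfolding M_def F_def using \<rho>\<gamma>(1-3) by blast
  then have "d \<le> Max M" using fin by (intro Max_ge)
  then show ?thesis
    unfolding d_def R_def rigidity_rank_def generic_rigidity_rank_def M_def .
qed

section \<open>Level sets of constant rank\<close>

lemma linear_frame_operator: "linear (\<lambda>h. \<Sum>k\<in>S. inner (g k) h *\<^sub>R v k)"
  by (rule linearI) (simp_all add: inner_add_right scaleR_add_left sum.distrib scaleR_sum_right)

text \<open>Pairing the image of \<open>h\<close> with \<open>h\<close> gives the sum of the squares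
  of the \<open>inner (v k) h\<close>; it vanishes only if \<open>h\<close> is orthogonal to a
  spanning set.\<close>

lemma inj_frame_operator:
  fixes v :: "'k \<Rightarrow> 'a::euclidean_space"
  assumes "finite S" "span (v ` S) = UNIV"
  shows "inj (\<lambda>h. \<Sum>k\<in>S. inner (v k) h *\<^sub>R v k)"
  unfolding linear_injective_0[OF linear_frame_operator]
proof (intro allI impI)
  fix h assume "(\<Sum>k\<in>S. inner (v k) h *\<^sub>R v k) = 0"
  then have "inner (\<Sum>k\<in>S. inner (v k) h *\<^sub>R v k) h = 0" by simp
  then have "(\<Sum>k\<in>S. (inner (v k) h)\<^sup>2) = 0" by (simp add: inner_sum_left power2_eq_square)
  then have "\<forall>k\<in>S. inner (v k) h = 0"
    using assms(1) by (simp add: sum_nonneg_eq_0_iff)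
  then have "Linear_Algebra.orthogonal h x" if "x \<in> v ` S" for x
    using that by (auto simp: Linear_Algebra.orthogonal_def inner_commute)
  then have "Linear_Algebra.orthogonal h h"
    using orthogonal_to_span[of h "v ` S" h] assms(2) by simp
  then show "h = 0" by (simp add: Linear_Algebra.orthogonal_def)
qed

text \<open>The constraints are bundled into a map \<open>F\<close> of the space to itself whose
  derivative at \<open>p\<close> is an injective frame operator. Such an operator is bounded below,
  so near \<open>p\<close> the value \<open>F p\<close> is taken at \<open>p\<close> alone.\<close>

lemma isolated_if_gradients_span:
  fixes f :: "'r \<Rightarrow> 'a::euclidean_space \<Rightarrow> real"
  assumes "finite J"
    and deriv: "\<And>r. r \<in> J \<Longrightarrow> (f r has_derivative (\<lambda>h. inner (g r) h)) (at p)"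
    and span: "span (g ` J) = UNIV"
  shows "p isolated_in {x. \<forall>r\<in>J. f r x = f r p}"
proof -
  define F where "F x = (\<Sum>r\<in>J. f r x *\<^sub>R g r)" for x
  define A where "A h = (\<Sum>r\<in>J. inner (g r) h *\<^sub>R g r)" for h
  have "(F has_derivative A) (at p)"
    unfolding F_def[abs_def] A_def[abs_def] by (intro has_derivative_sum has_derivative_scaleR_left deriv)
  then have D: "\<And>e. e > 0 \<Longrightarrow> \<exists>d>0. \<forall>y. norm (y - p) < d \<longrightarrow>
      norm (F y - F p - A (y - p)) \<le> e * norm (y - p)"
    by (simp add: has_derivative_at_alt)
  have A: "linear A" "inj A"
    unfolding A_def[abs_def] by (rule linear_frame_operator, rule inj_frame_operator[OF assms(1) span])
  obtain B where B: "B > 0" "\<And>x. B * norm x \<le> norm (A x)"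
    using linear_inj_bounded_below_pos[OF A] by metis
  \<comment> \<open>Any factor below \<open>B\<close> would do; \<open>B / 2\<close> keeps the
    linearization error strictly below the growth of \<open>A\<close>.\<close>
  obtain d where d: "d > 0" "\<And>y. norm (y - p) < d \<Longrightarrow> norm (F y - F p - A (y - p)) \<le> B / 2 * norm (y - p)"
    using D[of "B / 2"] B(1) by auto
  have "y = p" if y: "\<forall>r\<in>J. f r y = f r p" "dist p y < d" for y
  proof -
    have "F y = F p" unfolding F_def using y(1) by (intro sum.cong) auto
    then have "norm (A (y - p)) \<le> B / 2 * norm (y - p)"
      using d(2)[of y] y(2) by (simp add: dist_norm norm_minus_commute)
    then have "B * norm (y - p) \<le> B / 2 * norm (y - p)" using B(2)[of "y - p"] by linarith
    then have "norm (y - p) \<le> 0" using B(1) by (simp add: field_simps)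
    then show ?thesis by simp
  qed
  then show ?thesis using d(1) unfolding isolated_in_dist_Ex_iff by auto
qed

text \<open>The constant rank theorem: the maximal independent gradients, completed by linear functions, are
  local coordinates near \<open>p\<close>.  Moving along a linear coordinate keeps the chosen functions constant,
  and also the remaining ones, whose gradients are combinations of the chosen gradients.\<close>

lemma not_isolated_if_constant_rank:
  fixes f :: "'r \<Rightarrow> 'a::euclidean_space \<Rightarrow> real"
  assumes "finite J"
    and deriv: "\<And>r x. r \<in> J \<Longrightarrow> (f r has_derivative (\<lambda>h. inner (g r x) h)) (at x)"
    and cont: "\<And>r. r \<in> J \<Longrightarrow> continuous_on UNIV (g r)"
    and maxrank: "\<And>x. dim ((\<lambda>r. g r x) ` J) \<le> dim ((\<lambda>r. g r p) ` J)"
    and small: "dim ((\<lambda>r. g r p) ` J) < DIM('a)"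
  shows "\<not> p isolated_in {x. \<forall>r\<in>J. f r x = f r p}"
proof -
  obtain B where B: "B \<subseteq> (\<lambda>r. g r p) ` J" "independent B" "card B = dim ((\<lambda>r. g r p) ` J)"
    by (rule basis_exists[of "(\<lambda>r. g r p) ` J"])
  have finB: "finite B" using B(2) by (rule independent_imp_finite)
  \<comment> \<open>One constraint for each member of the gradient basis \<open>B\<close> at
    \<open>p\<close>.\<close>
  define I where "I = inv_into J (\<lambda>r. g r p) ` B"
  have IJ: "I \<subseteq> J" using B(1) by (auto simp: I_def inv_into_into)
  have gI: "(\<lambda>r. g r p) ` I = B" and inj_gI: "inj_on (\<lambda>r. g r p) I"
  proof -
    have "g (inv_into J (\<lambda>r. g r p) b) p = b" if "b \<in> B" for b
      using f_inv_into_f[of b "\<lambda>r. g r p" J] B(1) that by auto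
    then show "(\<lambda>r. g r p) ` I = B" "inj_on (\<lambda>r. g r p) I"
      by (auto simp: I_def image_image inj_on_def)
  qed
  have finI: "finite I" using IJ assms(1) finite_subset by blast
  have cardI: "card I = card B" using card_image[OF inj_gI] gI by simp
  obtain B' where B': "B \<subseteq> B'" "B' \<subseteq> UNIV" "independent B'" "UNIV \<subseteq> span B'"
    by (rule maximal_independent_subset_extend[OF subset_UNIV B(2)])
  have finB': "finite B'" using B'(3) by (rule independent_imp_finite)
  \<comment> \<open>The linear coordinates. Since the rank is below the dimension, \<open>N\<close>
    contains some \<open>b\<close>, the direction of motion.\<close>
  define N where "N = B' - B"
  have spanB': "span B' = UNIV" using B'(4) by blast
  have "card B' = DIM('a)" using spanB' dim_eq_full[of B'] dim_eq_card_independent[OF B'(3)] by simp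
  then have "B \<noteq> B'" using B(3) small by auto
  then obtain b where b: "b \<in> N" using B'(1) by (auto simp: N_def)
  have "b \<noteq> 0" using b B'(3) dependent_zero[of B'] by (auto simp: N_def)

  define S where "S = I <+> N"
  have inS: "Inl r \<in> S \<longleftrightarrow> r \<in> I" "Inr c \<in> S \<longleftrightarrow> c \<in> N" for r c by (auto simp: S_def)
  define f' where "f' k x = (case k of Inl r \<Rightarrow> f r x | Inr c \<Rightarrow> inner c x)" for k x
  define g' where "g' k x = (case k of Inl r \<Rightarrow> g r x | Inr c \<Rightarrow> c)" for k x
  have finS: "finite S" using finI finB' by (simp add: S_def N_def)
  have imS: "(\<lambda>k. g' k p) ` S = B'"
    using gI B'(1) by (simp add: S_def Plus_def image_Un image_image g'_def N_def) auto
  have "card S = card B'"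
    using finI finB' cardI card_Diff_subset[OF finB B'(1)] card_mono[OF finB' B'(1)]
    by (simp add: S_def N_def card_Plus)
  then have indepS: "indep_family (\<lambda>k. g' k p) S"
    using imS finS B'(3) by (simp add: indep_family_def eq_card_imp_inj_on)
  have coeff: "a k = c k"
    if eq: "(\<Sum>k\<in>S. a k *\<^sub>R g' k p) = (\<Sum>k\<in>S. c k *\<^sub>R g' k p)" and "k \<in> S" for a c k
  proof -
    have "(\<Sum>k\<in>S. (a k - c k) *\<^sub>R g' k p) = 0" using eq by (simp add: scaleR_diff_left sum_subtractf)
    then have "a k - c k = 0"
      using indepS[unfolded indep_family_iff[OF finS], rule_format, of "\<lambda>k. a k - c k" k] that(2) by simp
    then show ?thesis by simp
  qed
  have bS: "(\<Sum>k\<in>S. (if k = Inr b then t else 0) *\<^sub>R g' k p) = t *\<^sub>R b" for t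
  proof -
    have "(\<Sum>k\<in>S. (if k = Inr b then t else 0) *\<^sub>R g' k p) = (\<Sum>k\<in>S. if k = Inr b then t *\<^sub>R b else 0)"
      by (intro sum.cong) (auto simp: g'_def)
    also have "\<dots> = t *\<^sub>R b" using finS b by (simp add: inS)
    finally show ?thesis .
  qed
  \<comment> \<open>Attaching each coordinate function to its own basis vector makes
    \<open>\<Phi>\<close> a map of the space to itself, and the coordinates can be read off again by
    \<open>coeff\<close>.\<close>
  define \<Phi> where "\<Phi> x = (\<Sum>k\<in>S. f' k x *\<^sub>R g' k p)" for x
  define A where "A x h = (\<Sum>k\<in>S. inner (g' k x) h *\<^sub>R g' k p)" for x h
  define D where "D x = Blinfun (A x)" for x
  have lin: "linear (A x)" for x unfolding A_def[abs_def] by (rule linear_frame_operator)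
  have D: "blinfun_apply (D x) = A x" for x
    unfolding D_def using lin linear_conv_bounded_linear by (intro bounded_linear_Blinfun_apply) blast
  have deriv': "(f' k has_derivative (\<lambda>h. inner (g' k x) h)) (at x)" if "k \<in> S" for k x
  proof (cases k)
    case (Inl r)
    then show ?thesis using deriv[of r x] IJ that by (auto simp: f'_def[abs_def] g'_def S_def)
  next
    case (Inr c)
    then show ?thesis
      by (auto simp: f'_def[abs_def] g'_def intro!: bounded_linear_imp_has_derivative bounded_linear_inner_right)
  qed
  have D\<Phi>: "(\<Phi> has_derivative blinfun_apply (D x)) (at x)" for x
    unfolding D unfolding \<Phi>_def[abs_def] A_def[abs_def]
    by (intro has_derivative_sum has_derivative_scaleR_left deriv')
  have cont': "continuous_on UNIV (g' k)" if "k \<in> S" for k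
    using that cont IJ by (cases k) (auto simp: g'_def[abs_def] S_def)
  have contD: "continuous_on UNIV D"
    by (rule continuous_on_blinfun_componentwise)
      (auto simp: D A_def intro!: continuous_on_sum continuous_on_scaleR continuous_on_inner continuous_on_const cont')
  have "inj (A p)" unfolding A_def[abs_def] using finS spanB' imS by (intro inj_frame_operator) simp_all
  then obtain A' where A': "linear A'" "A' \<circ> A p = id" using linear_injective_left_inverse[OF lin] by blast
  have "blinfun_apply (Blinfun A') = A'"
    using A'(1) linear_conv_bounded_linear by (intro bounded_linear_Blinfun_apply) blast
  then have inv: "Blinfun A' o\<^sub>L D p = id_blinfun"
    using A'(2) by (intro blinfun_eqI) (simp add: D fun_eq_iff)
  have "\<exists>U V H H'. p \<in> U \<and> open V \<and> \<Phi> p \<in> V \<and> homeomorphism U V \<Phi> H \<and>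
      (\<forall>y\<in>V. (H has_derivative H' y) (at y) \<and> H' y = Hilbert_Choice.inv (blinfun_apply (D (H y))) \<and>
        bij (blinfun_apply (D (H y))))"
    by (rule inverse_function_theorem[OF open_UNIV D\<Phi> contD UNIV_I inv]) blast
  then obtain U V H H' where UV: "p \<in> U" "open V" "\<Phi> p \<in> V" "homeomorphism U V \<Phi> H"
    and H': "\<And>y. y \<in> V \<Longrightarrow> (H has_derivative H' y) (at y)"
      "\<And>y. y \<in> V \<Longrightarrow> H' y = Hilbert_Choice.inv (blinfun_apply (D (H y)))"
      "\<And>y. y \<in> V \<Longrightarrow> bij (blinfun_apply (D (H y)))"
    by blast
  obtain \<epsilon> where \<epsilon>: "\<epsilon> > 0" "ball (\<Phi> p) \<epsilon> \<subseteq> V" using UV(2,3) open_contains_ball by blast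
  define R where "R = \<epsilon> / norm b"
  have "R > 0" using \<epsilon>(1) \<open>b \<noteq> 0\<close> by (simp add: R_def)
  define T where "T = {-R<..<R}"
  define y where "y t = \<Phi> p + t *\<^sub>R b" for t
  \<comment> \<open>The preimage of a straight segment: along it only the coordinate belonging to
    \<open>b\<close> changes.\<close>
  define \<gamma> where "\<gamma> t = H (y t)" for t
  have T0: "0 \<in> T" using \<open>R > 0\<close> by (simp add: T_def)
  have yV: "y t \<in> V" if "t \<in> T" for t
  proof -
    have "\<bar>t\<bar> < \<epsilon> / norm b" using that by (auto simp: T_def R_def)
    then have "\<bar>t\<bar> * norm b < \<epsilon>" using \<open>b \<noteq> 0\<close> by (simp add: field_simps)
    then have "y t \<in> ball (\<Phi> p) \<epsilon>" by (simp add: y_def dist_norm)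
    then show ?thesis using \<epsilon>(2) by blast
  qed
  have \<Phi>\<gamma>: "\<Phi> (\<gamma> t) = y t" if "t \<in> T" for t
    using homeomorphism_apply2[OF UV(4) yV[OF that]] by (simp add: \<gamma>_def)
  have \<gamma>0: "\<gamma> 0 = p" using homeomorphism_apply1[OF UV(4,1)] by (simp add: \<gamma>_def y_def)
  have D\<gamma>: "(\<gamma> has_derivative (\<lambda>s. s *\<^sub>R H' (y t) b)) (at t)" if "t \<in> T" for t
  proof -
    have "(y has_derivative (\<lambda>s. s *\<^sub>R b)) (at t)"
      unfolding y_def[abs_def] by (auto intro!: derivative_eq_intros)
    then have "(\<gamma> has_derivative (\<lambda>s. H' (y t) (s *\<^sub>R b))) (at t)"
      unfolding \<gamma>_def[abs_def] using H'(1)[OF yV[OF that]] by (rule has_derivative_compose)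
    moreover have "H' (y t) (s *\<^sub>R b) = s *\<^sub>R H' (y t) b" for s
      using has_derivative_linear[OF H'(1)[OF yV[OF that]]] by (rule linear_scale)
    ultimately show ?thesis by simp
  qed
  have I_const: "f r (\<gamma> t) = f r p" if r: "r \<in> I" and t: "t \<in> T" for r t
  proof -
    have "(\<Sum>k\<in>S. f' k (\<gamma> t) *\<^sub>R g' k p) = \<Phi> p + t *\<^sub>R b"
      using \<Phi>\<gamma>[OF t] by (simp add: \<Phi>_def y_def)
    also have "\<dots> = (\<Sum>k\<in>S. (f' k p + (if k = Inr b then t else 0)) *\<^sub>R g' k p)"
      by (simp only: \<Phi>_def bS[symmetric] scaleR_add_left sum.distrib)
    finally have "f' (Inl r) (\<gamma> t) = f' (Inl r) p + (if Inl r = Inr b then t else 0)"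
      by (rule coeff) (use r in \<open>simp add: inS\<close>)
    then show ?thesis by (simp add: f'_def)
  qed
  have tangent: "inner (g r (\<gamma> t)) (H' (y t) b) = 0" if r: "r \<in> J" and t: "t \<in> T" for r t
  proof -
    have bij: "bij (A (\<gamma> t))" using H'(3)[OF yV[OF t]] by (simp add: D \<gamma>_def)
    \<comment> \<open>Invertibility of the derivative yields vectors dual to the chosen gradients,
      so these gradients stay independent along the curve.\<close>
    have ex: "\<exists>h. \<forall>s\<in>I. inner (g s (\<gamma> t)) h = (if s = q then 1 else 0)" if q: "q \<in> I" for q
    proof -
      obtain h where h: "A (\<gamma> t) h = g q p" using bij by (metis bij_pointE)
      have "(\<Sum>k\<in>S. inner (g' k (\<gamma> t)) h *\<^sub>R g' k p) = (\<Sum>k\<in>S. (if k = Inl q then 1 else 0) *\<^sub>R g' k p)"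
      proof -
        have "(\<Sum>k\<in>S. (if k = Inl q then 1 else 0) *\<^sub>R g' k p) = (\<Sum>k\<in>S. if k = Inl q then g q p else 0)"
          by (intro sum.cong) (auto simp: g'_def)
        also have "\<dots> = g q p" using finS q by (simp add: inS)
        finally show ?thesis using h by (simp add: A_def)
      qed
      then have "inner (g' k (\<gamma> t)) h = (if k = Inl q then 1 else 0)" if "k \<in> S" for k
        using that by (rule coeff)
      from this[of "Inl s" for s] show ?thesis by (intro exI[of _ h]) (auto simp: inS g'_def)
    qed
    have indep: "indep_family (\<lambda>s. g s (\<gamma> t)) I"
      unfolding indep_family_iff[OF finI]
    proof (intro allI impI ballI)
      fix c q assume c: "(\<Sum>s\<in>I. c s *\<^sub>R g s (\<gamma> t)) = 0" and q: "q \<in> I"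
      obtain h where h: "\<forall>s\<in>I. inner (g s (\<gamma> t)) h = (if s = q then 1 else 0)" using ex[OF q] by blast
      have "0 = inner (\<Sum>s\<in>I. c s *\<^sub>R g s (\<gamma> t)) h" using c by simp
      also have "\<dots> = (\<Sum>s\<in>I. if s = q then c s else 0)"
        unfolding inner_sum_left using h by (intro sum.cong) auto
      also have "\<dots> = c q" using finI q by simp
      finally show "c q = 0" by simp
    qed
    have "(\<lambda>s. g s (\<gamma> t)) ` I \<subseteq> (\<lambda>s. g s (\<gamma> t)) ` J" using IJ by (rule image_mono)
    \<comment> \<open>Maximality of the rank at \<open>p\<close> enters here: away from
      \<open>p\<close> the chosen gradients already exhaust the span of all gradients.\<close>
    moreover have "dim ((\<lambda>s. g s (\<gamma> t)) ` J) \<le> dim ((\<lambda>s. g s (\<gamma> t)) ` I)"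
      using maxrank[of "\<gamma> t"] indep_family_card_eq_dim[OF indep] cardI B(3) by simp
    ultimately have "span ((\<lambda>s. g s (\<gamma> t)) ` I) = span ((\<lambda>s. g s (\<gamma> t)) ` J)" by (rule dim_eq_span)
    then have gr: "g r (\<gamma> t) \<in> span ((\<lambda>s. g s (\<gamma> t)) ` I)" using r by (auto intro: span_base)
    \<comment> \<open>The velocity is sent to \<open>b\<close>, so its products with the chosen
      gradients are the coefficients of \<open>b\<close>, that is, zero.\<close>
    have "A (\<gamma> t) (H' (y t) b) = b"
      using H'(2)[OF yV[OF t]] bij by (simp add: D \<gamma>_def bij_is_surj surj_f_inv_f)
    then have eq: "(\<Sum>k\<in>S. inner (g' k (\<gamma> t)) (H' (y t) b) *\<^sub>R g' k p) =
        (\<Sum>k\<in>S. (if k = Inr b then 1 else 0) *\<^sub>R g' k p)"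
      unfolding bS by (simp add: A_def)
    have "inner (g s (\<gamma> t)) (H' (y t) b) = 0" if "s \<in> I" for s
      using coeff[OF eq, of "Inl s"] that by (simp add: inS g'_def)
    then have "Linear_Algebra.orthogonal (H' (y t) b) z" if "z \<in> (\<lambda>s. g s (\<gamma> t)) ` I" for z
      using that by (auto simp: Linear_Algebra.orthogonal_def inner_commute)
    then have "Linear_Algebra.orthogonal (H' (y t) b) (g r (\<gamma> t))"
      using orthogonal_to_span[OF gr] by blast
    then show ?thesis by (simp add: Linear_Algebra.orthogonal_def inner_commute)
  qed
  have J_const: "f r (\<gamma> t) = f r p" if r: "r \<in> J" and t: "t \<in> T" for r t
  proof -
    have "((\<lambda>t. f r (\<gamma> t)) has_derivative (\<lambda>s. 0)) (at s within T)" if s: "s \<in> T" for s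
    proof -
      have "((\<lambda>t. f r (\<gamma> t)) has_derivative (\<lambda>q. inner (g r (\<gamma> s)) (q *\<^sub>R H' (y s) b))) (at s)"
        by (rule has_derivative_compose[OF D\<gamma>[OF s] deriv[OF r]])
      then show ?thesis using tangent[OF r s] by (simp add: has_derivative_at_withinI)
    qed
    moreover have "convex T" by (simp add: T_def)
    ultimately obtain c where "\<And>s. s \<in> T \<Longrightarrow> f r (\<gamma> s) = c"
      using has_derivative_zero_constant[of T "\<lambda>t. f r (\<gamma> t)"] by blast
    from this[OF t] this[OF T0] show ?thesis by (simp add: \<gamma>0)
  qed
  show ?thesis
  proof
    assume "p isolated_in {x. \<forall>r\<in>J. f r x = f r p}"
    then obtain e where e: "e > 0" "\<And>x. (\<forall>r\<in>J. f r x = f r p) \<Longrightarrow> dist p x < e \<Longrightarrow> x = p"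
      unfolding isolated_in_dist_Ex_iff by auto
    have "isCont \<gamma> 0" using D\<gamma>[OF T0] by (rule has_derivative_continuous)
    then obtain d where d: "d > 0" "\<And>t. dist t 0 < d \<Longrightarrow> dist (\<gamma> t) (\<gamma> 0) < e"
      unfolding continuous_at_eps_delta using e(1) by blast
    define t where "t = min (d / 2) (R / 2)"
    have t0: "t > 0" using d(1) \<open>R > 0\<close> by (simp add: t_def)
    have "t \<le> R / 2" by (simp add: t_def)
    then have tT: "t \<in> T" using t0 by (simp add: T_def)
    have "dist t 0 < d" using t0 d(1) by (simp add: t_def dist_real_def)
    then have "dist p (\<gamma> t) < e" using d(2) \<gamma>0 by (simp add: dist_commute)
    then have "\<gamma> t = p" using e(2) J_const tT by blast
    \<comment> \<open>Returning to \<open>p\<close> would mean \<open>t *\<^sub>R b = 0\<close>, so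
      the curve really moves.\<close>
    then have "y t = \<Phi> p" using \<Phi>\<gamma>[OF tT] by simp
    then show False using t0 \<open>b \<noteq> 0\<close> by (simp add: y_def)
  qed
qed

section \<open>Pinned frameworks\<close>

text \<open>Halving the squared length makes the gradient equal to the rigidity row, without a
  factor 2.\<close>

definition constraint_value ::
    "('v::finite, 'e, 'l) looped_graph \<Rightarrow> ('l \<Rightarrow> real^2) \<Rightarrow> 'e + 'l \<Rightarrow> real^2^'v \<Rightarrow> real" where
  "constraint_value G nrm r x = (case r of
     Inl e \<Rightarrow> (norm (vec_nth x (row_tail G r) - vec_nth x (edge_head G e)))\<^sup>2 / 2
   | Inr l \<Rightarrow> inner (vec_nth x (base G l)) (nrm l))"

abbreviation rigidity_vec ::
    "('v::finite, 'e, 'l) looped_graph \<Rightarrow> ('l \<Rightarrow> real^2) \<Rightarrow> 'e + 'l \<Rightarrow> real^2^'v \<Rightarrow> real^2^'v" where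
  "rigidity_vec G nrm r x \<equiv> row_vec G r (row_dir G x nrm r)"

lemma has_derivative_constraint_value:
  "(constraint_value G nrm r has_derivative (\<lambda>h. inner (rigidity_vec G nrm r x) h)) (at x)"
proof -
  have nth: "((\<lambda>x. vec_nth x v) has_derivative (\<lambda>h. vec_nth h v)) (at x)" for v
    by (intro bounded_linear_imp_has_derivative bounded_linear_vec_nth)
  show ?thesis
  proof (cases r)
    case (Inl e)
    let ?d = "\<lambda>x. vec_nth x (row_tail G (Inl e)) - vec_nth x (edge_head G e)"
    have "((\<lambda>x. inner (?d x) (?d x)) has_derivative (\<lambda>h. inner (?d x) (?d h) + inner (?d h) (?d x))) (at x)"
      by (intro has_derivative_inner has_derivative_diff nth)
    then have "((\<lambda>x. inner (?d x) (?d x) / 2) has_derivative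
        (\<lambda>h. (inner (?d x) (?d h) + inner (?d h) (?d x)) / 2)) (at x)"
      by (rule bounded_linear.has_derivative[OF bounded_linear_divide])
    moreover have "(inner (?d x) (?d h) + inner (?d h) (?d x)) / 2 = inner (rigidity_vec G nrm r x) h" for h
      by (simp add: Inl inner_row_vec inner_commute[of "?d h" "?d x"])
    moreover have "constraint_value G nrm r = (\<lambda>x. inner (?d x) (?d x) / 2)"
      by (simp add: fun_eq_iff constraint_value_def Inl power2_norm_eq_inner)
    ultimately show ?thesis by simp
  next
    case (Inr l)
    have "((\<lambda>x. inner (nrm l) (vec_nth x (base G l))) has_derivative
        (\<lambda>h. inner (nrm l) (vec_nth h (base G l)))) (at x)"
      by (intro has_derivative_inner_right nth)
    moreover have "constraint_value G nrm r = (\<lambda>x. inner (nrm l) (vec_nth x (base G l)))"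
      by (simp add: fun_eq_iff constraint_value_def Inr inner_commute)
    ultimately show ?thesis by (simp add: Inr inner_row_vec)
  qed
qed

lemma continuous_on_rigidity_vec: "continuous_on UNIV (rigidity_vec G nrm r)"
proof -
  have "continuous_on UNIV (\<lambda>x. row_dir G x nrm r)"
    by (cases r) (simp_all add: continuous_on_diff continuous_on_component)
  then show ?thesis
    using linear_continuous_on_compose[OF _ linear_row_vec] by blast
qed

lemma rigidity_rank_vec:
  "wf_looped_graph G \<Longrightarrow> rigidity_rank G x nrm = dim ((\<lambda>r. rigidity_vec G nrm r x) ` rigidity_rows G)"
  by (rule rigidity_rank_eq_dim)

lemma ball_Plus: "(\<forall>r\<in>A <+> B. P r) \<longleftrightarrow> (\<forall>a\<in>A. P (Inl a)) \<and> (\<forall>b\<in>B. P (Inr b))"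
  by (auto simp: Plus_def)

text \<open>As \<open>p\<close> is itself a realization, the prescribed lengths and offsets are the
  values at \<open>p\<close>, which brings in the results on level sets.\<close>

lemma configuration_space_eq_level_set:
  fixes p :: "real^2^'v::finite"
  assumes wf: "wf_looped_graph G" and p: "p \<in> configuration_space G len nrm s"
  shows "configuration_space G len nrm s =
    {x. \<forall>r\<in>rigidity_rows G. constraint_value G nrm r x = constraint_value G nrm r p}"
proof -
  let ?d = "\<lambda>e (x :: real^2^'v). vec_nth x (row_tail G (Inl e)) - vec_nth x (edge_head G e)"
  have edge: "(\<forall>i j. ends G e = {i, j} \<longrightarrow> (norm (vec_nth x i - vec_nth x j))\<^sup>2 = len e) \<longleftrightarrow>
      (norm (?d e x))\<^sup>2 = len e" if "e \<in> edges G" for e and x :: "real^2^'v"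
  proof -
    have "card (ends G e) = 2" using wf that by (simp add: wf_looped_graph_def)
    from edge_ends(1)[OF this] have "ends G e = {row_tail G (Inl e), edge_head G e}" .
    then show ?thesis by (auto simp: doubleton_eq_iff norm_minus_commute)
  qed
  have mem: "x \<in> configuration_space G len nrm s \<longleftrightarrow>
      (\<forall>e\<in>edges G. (norm (?d e x))\<^sup>2 = len e) \<and>
      (\<forall>l\<in>loops G. inner (vec_nth x (base G l)) (nrm l) = s l)" for x
    unfolding configuration_space_def using edge by simp
  have "x \<in> configuration_space G len nrm s \<longleftrightarrow>
      (\<forall>e\<in>edges G. (norm (?d e x))\<^sup>2 = (norm (?d e p))\<^sup>2) \<and>
      (\<forall>l\<in>loops G. inner (vec_nth x (base G l)) (nrm l) = inner (vec_nth p (base G l)) (nrm l))" for x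
    using p unfolding mem by simp
  then show ?thesis
    by (auto simp: rigidity_rows_def constraint_value_def ball_Plus)
qed

lemma pinned_if_full_rank:
  fixes p :: "real^2^'v::finite"
  assumes wf: "wf_looped_graph G" and p: "p \<in> configuration_space G len nrm s"
    and rank: "rigidity_rank G p nrm = 2 * CARD('v)"
  shows "pinned G len nrm s p"
  unfolding pinned_def configuration_space_eq_level_set[OF wf p]
proof (rule isolated_if_gradients_span[OF finite_rigidity_rows[OF wf] has_derivative_constraint_value])
  show "span ((\<lambda>r. rigidity_vec G nrm r p) ` rigidity_rows G) = UNIV"
    using rank unfolding rigidity_rank_vec[OF wf] dim_eq_full[symmetric] by simp
qed

text \<open>Maximality is over positions with fixed normals, because the normals are part of the
  constraints and only the points move.\<close>

lemma not_pinned_if_max_rank: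
  fixes p :: "real^2^'v::finite"
  assumes wf: "wf_looped_graph G" and p: "p \<in> configuration_space G len nrm s"
    and rank: "rigidity_rank G p nrm < 2 * CARD('v)"
    and max: "\<And>x. rigidity_rank G x nrm \<le> rigidity_rank G p nrm"
  shows "\<not> pinned G len nrm s p"
  unfolding pinned_def configuration_space_eq_level_set[OF wf p]
  using rank max
  by (intro not_isolated_if_constant_rank[where g = "rigidity_vec G nrm"] finite_rigidity_rows[OF wf]
      has_derivative_constraint_value continuous_on_rigidity_vec)
    (simp_all add: rigidity_rank_vec[OF wf])

text \<open>The rank never exceeds the number of rows, so independence at \<open>p\<close> makes the
  rank there maximal. This serves frameworks with a deleted constraint, for which no genericity is
  assumed.\<close>

lemma not_pinned_if_independent_rows:
  fixes p :: "real^2^'v::finite"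
  assumes wf: "wf_looped_graph G" and p: "p \<in> configuration_space G len nrm s"
    and indep: "indep_family (\<lambda>r. rigidity_vec G nrm r p) (rigidity_rows G)"
    and few: "card (rigidity_rows G) < 2 * CARD('v)"
  shows "\<not> pinned G len nrm s p"
proof (rule not_pinned_if_max_rank[OF wf p])
  have eq: "rigidity_rank G p nrm = card (rigidity_rows G)"
    unfolding rigidity_rank_vec[OF wf] by (rule indep_family_card_eq_dim[OF indep])
  then show "rigidity_rank G p nrm < 2 * CARD('v)" using few by simp
  fix x
  have "rigidity_rank G x nrm \<le> card ((\<lambda>r. rigidity_vec G nrm r x) ` rigidity_rows G)"
    unfolding rigidity_rank_vec[OF wf] using finite_rigidity_rows[OF wf] by (intro dim_le_card') simp
  also have "\<dots> \<le> card (rigidity_rows G)" using finite_rigidity_rows[OF wf] by (rule card_image_le)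
  finally show "rigidity_rank G x nrm \<le> rigidity_rank G p nrm" using eq by simp
qed

section \<open>Deleting a single constraint\<close>

definition remove_row :: "'e + 'l \<Rightarrow> ('v, 'e, 'l) looped_graph \<Rightarrow> ('v, 'e, 'l) looped_graph" where
  "remove_row r G = (case r of Inl e \<Rightarrow> remove_edge e G | Inr l \<Rightarrow> remove_loop l G)"

lemma ends_base_remove_row [simp]: "ends (remove_row r G) = ends G" "base (remove_row r G) = base G"
  by (cases r; simp add: remove_row_def remove_edge_def remove_loop_def)+

lemma edges_loops_remove_row: "edges (remove_row r G) \<subseteq> edges G" "loops (remove_row r G) \<subseteq> loops G"
  by (cases r; auto simp: remove_row_def remove_edge_def remove_loop_def)+

lemma rigidity_rows_remove_row: "rigidity_rows (remove_row r G) = rigidity_rows G - {r}"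
  by (cases r) (auto simp: remove_row_def remove_edge_def remove_loop_def rigidity_rows_def)

text \<open>The chosen tails and heads depend only on \<open>ends\<close> and \<open>base\<close>,
  which deletion leaves unchanged.\<close>

lemma rigidity_vec_remove_row: "rigidity_vec (remove_row r G) nrm q x = rigidity_vec G nrm q x"
proof -
  have oe: "other_end (remove_row r G) = other_end G" by (simp add: other_end_def fun_eq_iff)
  have rt: "row_tail (remove_row r G) = row_tail G"
    by (simp add: row_tail_def fun_eq_iff split: sum.split)
  have "edge_head (remove_row r G) = edge_head G"
    by (simp add: edge_head_def fun_eq_iff oe rt)
  moreover have "row_head (remove_row r G) = row_head G"
    by (simp add: row_head_def fun_eq_iff oe rt split: sum.split)
  ultimately show ?thesis by (simp add: row_vec_def row_dir_def rt cong: sum.case_cong)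
qed

lemma wf_remove_row:
  assumes "wf_looped_graph G"
  shows "wf_looped_graph (remove_row r G)"
proof -
  note sub = edges_loops_remove_row[of r G]
  have fin: "finite (edges G)" "finite (loops G)" using assms by (auto simp: wf_looped_graph_def)
  have "card {f \<in> edges (remove_row r G). ends G f = ends G e} \<le> 2" if "e \<in> edges G" for e
  proof -
    have "card {f \<in> edges (remove_row r G). ends G f = ends G e} \<le> card {f \<in> edges G. ends G f = ends G e}"
      using sub(1) fin by (intro card_mono) auto
    then show ?thesis using assms that by (fastforce simp: wf_looped_graph_def)
  qed
  moreover have "card {l \<in> loops (remove_row r G). base G l = v} \<le> 2" for v
  proof -
    have "card {l \<in> loops (remove_row r G). base G l = v} \<le> card {l \<in> loops G. base G l = v}"
      using sub(2) fin by (intro card_mono) auto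
    also have "\<dots> \<le> 2" using assms by (simp add: wf_looped_graph_def)
    finally show ?thesis .
  qed
  ultimately show ?thesis
    using assms sub finite_subset[OF sub(1) fin(1)] finite_subset[OF sub(2) fin(2)]
    by (auto simp: wf_looped_graph_def)
qed

lemma configuration_space_remove_row:
  "p \<in> configuration_space G len nrm s \<Longrightarrow> p \<in> configuration_space (remove_row r G) len nrm s"
  using edges_loops_remove_row[of r G] by (auto simp: configuration_space_def)

lemma minimally_pinned_iff:
  "minimally_pinned G len nrm s p \<longleftrightarrow> pinned G len nrm s p \<and>
     (\<forall>r\<in>rigidity_rows G. \<not> pinned (remove_row r G) len nrm s p)"
  by (simp add: minimally_pinned_def rigidity_rows_def remove_row_def ball_Plus)

lemma rigidity_rank_le: "rigidity_rank G (p :: real^2^'v::finite) nrm \<le> 2 * CARD('v)"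
proof -
  have "rigidity_rank G p nrm \<le> DIM(real^('v \<times> 2))"
    unfolding rigidity_rank_def by (rule dim_subset_UNIV)
  then show ?thesis by simp
qed

lemma minimally_pinned_if_laman:
  assumes wf: "wf_looped_graph G" and p: "p \<in> configuration_space G len nrm s"
    and generic: "generic_realization G nrm p" and laman: "looped_laman G"
  shows "minimally_pinned G len nrm s (p :: real^2^'v::finite)"
proof -
  obtain p' nrm' where "rigidity_rank G (p' :: real^2^'v) nrm' = 2 * CARD('v)"
    using laman_ex_full_rank[OF wf laman] by blast
  \<comment> \<open>Full rank at some other realization bounds the generic rank from below, and
    genericity carries the bound to \<open>p\<close>.\<close>
  then have "2 * CARD('v) \<le> rigidity_rank G p nrm"
    using rigidity_rank_le_generic[of G p' nrm'] generic by (simp add: generic_realization_def)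
  then have rank: "rigidity_rank G p nrm = 2 * CARD('v)" using rigidity_rank_le[of G p nrm] by simp
  have card: "card (rigidity_rows G) = 2 * CARD('v)"
    using laman by (simp add: card_rigidity_rows[OF wf] looped_laman_def)
  have indep: "indep_family (\<lambda>r. rigidity_vec G nrm r p) (rigidity_rows G)"
    using rank unfolding rigidity_rank_vec[OF wf] card[symmetric]
    by (intro indep_family_if_card_le_dim finite_rigidity_rows[OF wf]) simp
  have "\<not> pinned (remove_row r G) len nrm s p" if r: "r \<in> rigidity_rows G" for r
  proof (rule not_pinned_if_independent_rows[OF wf_remove_row[OF wf] configuration_space_remove_row[OF p]])
    show "indep_family (\<lambda>q. rigidity_vec (remove_row r G) nrm q p) (rigidity_rows (remove_row r G))"
      unfolding rigidity_vec_remove_row rigidity_rows_remove_row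
      using indep by (rule indep_family_subset) auto
    show "card (rigidity_rows (remove_row r G)) < 2 * CARD('v)"
      unfolding rigidity_rows_remove_row card[symmetric]
      using finite_rigidity_rows[OF wf] r by (rule card_Diff1_less)
  qed
  then show ?thesis using pinned_if_full_rank[OF wf p rank] by (simp add: minimally_pinned_iff)
qed

section \<open>Counts for independent rows supported on a vertex set\<close>

lemma axis_eq_sum_Basis: "axis v d = (\<Sum>b\<in>Basis. inner d b *\<^sub>R axis v b)"
proof -
  have "axis v d = axis v (\<Sum>b\<in>Basis. inner d b *\<^sub>R b)" by (simp add: euclidean_representation)
  also have "\<dots> = (\<Sum>b\<in>Basis. inner d b *\<^sub>R axis v b)"
    by (simp only: linear_sum[OF linear_axis] linear_scale[OF linear_axis])
  finally show ?thesis .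
qed

lemma row_vec_in_span_axes:
  assumes "row_tail G r \<in> C" "set_option (row_head G r) \<subseteq> C"
  shows "row_vec G r d \<in> span ((\<lambda>(v, b). axis v b) ` (C \<times> Basis))"
proof -
  have ax: "axis v d \<in> span ((\<lambda>(v, b). axis v b) ` (C \<times> Basis))" if "v \<in> C" for v
  proof -
    have "axis v d = (\<Sum>b\<in>Basis. inner d b *\<^sub>R axis v b)" by (rule axis_eq_sum_Basis)
    also have "\<dots> \<in> span ((\<lambda>(v, b). axis v b) ` (C \<times> Basis))"
      using that by (intro span_sum span_mul span_base) force
    finally show ?thesis .
  qed
  show ?thesis
    using assms ax by (cases "row_head G r") (auto simp: row_vec_def incidence_vector_def intro: span_diff)
qed

lemma dim_span_axes_le:
  fixes C :: "'v::finite set"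
  assumes "X \<subseteq> span ((\<lambda>(v, b). axis v b :: real^2^'v) ` (C \<times> Basis))"
  shows "dim X \<le> 2 * card C"
proof -
  have "dim X \<le> card ((\<lambda>(v, b). axis v b :: real^2^'v) ` (C \<times> Basis))"
    using assms by (intro dim_le_card) auto
  also have "\<dots> \<le> card (C \<times> (Basis :: (real^2) set))" by (intro card_image_le) auto
  finally show ?thesis by (simp add: card_cartesian_product)
qed

text \<open>The restrictions of two translations and a rotation to \<open>C\<close> are orthogonal to the rows of the
  edges inside \<open>C\<close>.\<close>

lemma card_edges_if_independent:
  fixes p :: "real^2^'v::finite"
  assumes wf: "wf_looped_graph G" and E: "E' \<subseteq> edges G" "\<forall>e\<in>E'. ends G e \<subseteq> C" "E' \<noteq> {}"
    and indep: "indep_family (\<lambda>r. rigidity_vec G nrm r p) (Inl ` E')"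
    and distinct: "\<And>e. e \<in> E' \<Longrightarrow> vec_nth p (row_tail G (Inl e)) \<noteq> vec_nth p (edge_head G e)"
  shows "card E' + 3 \<le> 2 * card C"
proof -
  have ends: "row_tail G (Inl e) \<in> C" "edge_head G e \<in> C" if "e \<in> E'" for e
    using edge_ends(1)[of G e] E(1,2) that wf by (auto simp: wf_looped_graph_def)
  define m :: "nat \<Rightarrow> real^2 \<Rightarrow> real^2" where
    "m k x = (if k = 0 then axis 1 1 else if k = 1 then axis 2 1 else rot90 x)" for k x
  define u :: "nat \<Rightarrow> real^2^'v" where "u k = (\<chi> v. if v \<in> C then m k (vec_nth p v) else 0)" for k
  let ?X = "(\<lambda>r. rigidity_vec G nrm r p) ` Inl ` E'" and ?U = "u ` {0, 1, 2}"
  obtain e where e: "e \<in> E'" using E(3) by blast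
  have "indep_family u {0, 1, 2}"
    unfolding indep_family_iff[OF finite.insertI[OF finite.insertI[OF finite.insertI[OF finite.emptyI]]]]
  proof (intro allI impI)
    fix c assume c: "(\<Sum>k\<in>{0, 1, 2}. c k *\<^sub>R u k) = 0"
    have at: "c 0 *\<^sub>R axis 1 1 + c 1 *\<^sub>R axis 2 1 + c 2 *\<^sub>R rot90 (vec_nth p v) = 0" if "v \<in> C" for v
    proof -
      have "vec_nth (\<Sum>k\<in>{0, 1, 2}. c k *\<^sub>R u k) v = 0" using c by simp
      then show ?thesis using that by (simp add: u_def m_def add.assoc)
    qed
    note eqs = at[OF ends(1)[OF e]] at[OF ends(2)[OF e]]
    \<comment> \<open>Subtracting the equations at the two ends of an edge cancels the translations;
      as these ends are distinct points, the rotation has coefficient zero.\<close>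
    then have "c 2 *\<^sub>R (rot90 (vec_nth p (row_tail G (Inl e))) - rot90 (vec_nth p (edge_head G e))) = 0"
      by (metis (no_types, lifting) add_diff_cancel_left diff_self scaleR_diff_right)
    moreover have "rot90 (vec_nth p (row_tail G (Inl e))) \<noteq> rot90 (vec_nth p (edge_head G e))"
      using distinct[OF e] by (auto simp: vec_eq_real2)
    ultimately have c2: "c 2 = 0" by simp
    then have "c 0 = 0 \<and> c 1 = 0" using eqs(1) by (simp add: vec_eq_real2 axis_def)
    then show "\<forall>k\<in>{0, 1, 2}. c k = 0" using c2 by simp
  qed
  then have "dim ?U = card {0, 1, 2 :: nat}" by (rule indep_family_card_eq_dim)
  then have "dim ?U = 3" by (simp del: image_insert)
  moreover have "dim ?X = card E'"
    using indep_family_card_eq_dim[OF indep] by (simp add: card_image)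
  moreover have "dim (?X \<union> ?U) = dim ?X + dim ?U"
  proof (rule dim_orthogonal_sum)
    fix x y assume "x \<in> ?X" "y \<in> ?U"
    then obtain f k where fk: "f \<in> E'" "x = rigidity_vec G nrm (Inl f) p" "y = u k" by auto
    show "inner x y = 0"
      using ends[OF fk(1)] inner_rot90[of "vec_nth p (row_tail G (Inl f)) - vec_nth p (edge_head G f)"]
      by (simp add: fk(2,3) inner_row_vec u_def m_def rot90_diff)
  qed
  moreover have "dim (?X \<union> ?U) \<le> 2 * card C"
  proof (rule dim_span_axes_le, rule Un_least)
    show "?X \<subseteq> span ((\<lambda>(v, b). axis v b) ` (C \<times> Basis))"
      using ends by (auto intro!: row_vec_in_span_axes)
    have "u k \<in> span ((\<lambda>(v, b). axis v b) ` (C \<times> Basis))" for k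
    proof -
      have "u k = (\<Sum>v\<in>C. \<Sum>b\<in>Basis. inner (m k (vec_nth p v)) b *\<^sub>R axis v b)"
      proof -
        have "(\<Sum>v\<in>C. \<Sum>b\<in>Basis. inner (m k (vec_nth p v)) b *\<^sub>R axis v b) =
            (\<Sum>v\<in>C. axis v (m k (vec_nth p v)))"
          by (intro sum.cong refl) (rule axis_eq_sum_Basis[symmetric])
        also have "\<dots> = u k"
          by (subst Finite_Cartesian_Product.vec_eq_iff) (simp add: u_def axis_def)
        finally show ?thesis by simp
      qed
      also have "\<dots> \<in> span ((\<lambda>(v, b). axis v b) ` (C \<times> Basis))"
        by (intro span_sum span_mul span_base) force
      finally show ?thesis .
    qed
    then show "?U \<subseteq> span ((\<lambda>(v, b). axis v b) ` (C \<times> Basis))" by auto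
  qed
  ultimately show ?thesis by simp
qed

lemma laman_if_minimally_pinned:
  assumes wf: "wf_looped_graph G" and p: "p \<in> configuration_space G len nrm s"
    and len: "\<And>e. e \<in> edges G \<Longrightarrow> len e > 0"
    and generic: "generic_realization G nrm p"
    and min: "minimally_pinned G len nrm s (p :: real^2^'v::finite)"
  shows "looped_laman G"
proof -
  have pin: "pinned G len nrm s p"
    and nopin: "\<And>r. r \<in> rigidity_rows G \<Longrightarrow> \<not> pinned (remove_row r G) len nrm s p"
    using min by (auto simp: minimally_pinned_iff)
  \<comment> \<open>By genericity the rank at \<open>p\<close> is maximal among all positions, so a
    rank below 2n would produce a motion through \<open>p\<close>.\<close>
  have "\<not> rigidity_rank G p nrm < 2 * CARD('v)"
    using not_pinned_if_max_rank[OF wf p] pin rigidity_rank_le_generic generic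
    unfolding generic_realization_def by metis
  then have rank: "rigidity_rank G p nrm = 2 * CARD('v)" using rigidity_rank_le[of G p nrm] by simp
  let ?g = "\<lambda>r. rigidity_vec G nrm r p" and ?R = "rigidity_rows G"
  have finR: "finite ?R" using wf by (rule finite_rigidity_rows)
  \<comment> \<open>Minimality enters here: a row in the span of the others could be deleted without
    lowering the rank, and the framework would stay pinned.\<close>
  have indep: "indep_family ?g ?R"
  proof (rule ccontr)
    assume "\<not> indep_family ?g ?R"
    then obtain c r where c: "(\<Sum>q\<in>?R. c q *\<^sub>R ?g q) = 0" "r \<in> ?R" "c r \<noteq> 0"
      unfolding indep_family_iff[OF finR] by blast
    have "c r *\<^sub>R ?g r = - (\<Sum>q\<in>?R - {r}. c q *\<^sub>R ?g q)"
      using c(1) sum.remove[OF finR c(2), of "\<lambda>q. c q *\<^sub>R ?g q"] by (simp add: eq_neg_iff_add_eq_0)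
    also have "\<dots> \<in> span (?g ` (?R - {r}))"
      by (intro span_neg span_sum span_mul span_base) auto
    finally have "(1 / c r) *\<^sub>R (c r *\<^sub>R ?g r) \<in> span (?g ` (?R - {r}))" by (rule span_mul)
    then have "?g r \<in> span (?g ` (?R - {r}))" using c(3) by simp
    then have "dim (insert (?g r) (?g ` (?R - {r}))) = dim (?g ` (?R - {r}))" by (simp add: dim_insert)
    moreover have "insert (?g r) (?g ` (?R - {r})) = ?g ` ?R" using c(2) by blast
    ultimately have "rigidity_rank (remove_row r G) p nrm = 2 * CARD('v)"
      using rank unfolding rigidity_rank_vec[OF wf] rigidity_rank_vec[OF wf_remove_row[OF wf]]
        rigidity_vec_remove_row rigidity_rows_remove_row by simp
    then have "pinned (remove_row r G) len nrm s p"
      by (rule pinned_if_full_rank[OF wf_remove_row[OF wf] configuration_space_remove_row[OF p]])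
    then show False using nopin[OF c(2)] by contradiction
  qed
  have "card (edges G) + card (loops G) = 2 * CARD('v)"
    using rank indep_family_card_eq_dim[OF indep] card_rigidity_rows[OF wf]
    by (simp add: rigidity_rank_vec[OF wf])
  moreover have "card E' \<le> 2 * card C - 3" if sub: "is_subgraph C E' L' G" for C E' L'
  proof (cases "E' = {}")
    case False
    have E: "E' \<subseteq> edges G" "\<forall>e\<in>E'. ends G e \<subseteq> C" using sub by (auto simp: is_subgraph_def)
    \<comment> \<open>Positive lengths keep the two ends of an edge apart, which the independence of
      the rigid motions relies on.\<close>
    have "vec_nth p (row_tail G (Inl e)) \<noteq> vec_nth p (edge_head G e)" if e: "e \<in> E'" for e
    proof -
      have eG: "e \<in> edges G" using E(1) e by blast
      then have "ends G e = {row_tail G (Inl e), edge_head G e}"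
        using wf by (intro edge_ends) (simp add: wf_looped_graph_def)
      then have "(norm (vec_nth p (row_tail G (Inl e)) - vec_nth p (edge_head G e)))\<^sup>2 = len e"
        using p eG by (auto simp: configuration_space_def)
      then show ?thesis using len[OF eG] by auto
    qed
    moreover have "indep_family ?g (Inl ` E')"
      using indep by (rule indep_family_subset) (use E(1) in \<open>auto simp: rigidity_rows_def\<close>)
    ultimately have "card E' + 3 \<le> 2 * card C" by (intro card_edges_if_independent[OF wf E False])
    then show ?thesis by simp
  qed simp
  moreover have "card E' + card L' \<le> 2 * card C" if sub: "is_subgraph C E' L' G" for C E' L'
  proof -
    have EL: "E' \<subseteq> edges G" "L' \<subseteq> loops G" "\<forall>e\<in>E'. ends G e \<subseteq> C" "\<forall>l\<in>L'. base G l \<in> C"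
      using sub by (auto simp: is_subgraph_def)
    have fin: "finite E'" "finite L'" using EL(1,2) wf finite_subset by (auto simp: wf_looped_graph_def)
    have "indep_family ?g (E' <+> L')"
      using indep by (rule indep_family_subset) (use EL(1,2) in \<open>auto simp: rigidity_rows_def\<close>)
    then have "card E' + card L' = dim (?g ` (E' <+> L'))"
      by (simp add: indep_family_card_eq_dim card_Plus fin)
    also have "\<dots> \<le> 2 * card C"
    proof (rule dim_span_axes_le, rule image_subsetI, rule row_vec_in_span_axes)
      fix r assume r: "r \<in> E' <+> L'"
      have "row_tail G r \<in> C \<and> set_option (row_head G r) \<subseteq> C"
      proof (cases r)
        case (Inl e)
        then have e: "e \<in> E'" using r by auto
        then have "ends G e = {row_tail G (Inl e), edge_head G e}"
          using wf EL(1) by (intro edge_ends) (auto simp: wf_looped_graph_def)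
        moreover have "ends G e \<subseteq> C" using EL(3) e by blast
        ultimately show ?thesis using Inl by simp
      next
        case (Inr l)
        then show ?thesis using r EL(4) by auto
      qed
      then show "row_tail G r \<in> C" "set_option (row_head G r) \<subseteq> C" by simp_all
    qed
    finally show ?thesis .
  qed
  ultimately show ?thesis unfolding looped_laman_def by blast
qed

theorem theorem2:
  fixes G :: "('v::finite, 'e, 'l) looped_graph"
    and len :: "'e \<Rightarrow> real"
    and nrm :: "'l \<Rightarrow> real^2"
    and s :: "'l \<Rightarrow> real"
    and p :: "real^2^'v"
  assumes "bar_slider_framework G len nrm s"
    and "p \<in> configuration_space G len nrm s"
    and "generic_realization G nrm p"
  shows "minimally_pinned G len nrm s p \<longleftrightarrow> looped_laman G"
proof -
  have "wf_looped_graph G" "\<And>e. e \<in> edges G \<Longrightarrow> len e > 0"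
    using assms(1) by (auto simp: bar_slider_framework_def)
  then show ?thesis
    using minimally_pinned_if_laman[OF _ assms(2,3)] laman_if_minimally_pinned[OF _ assms(2) _ assms(3)]
    by blast
qed

end
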